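(* Let $p$ be a prime and let $A\subseteq\mathbb{F}_p$ satisfy $A-A\doteq\mathcal{R}_p$ (so in particular $p\equiv1\pmod 4$). Then the multiplier subgroup $M_A$ contains the unique subgroup of $\mathbb{F}_p^\times$ of order $G_p$; equivalently, $G_p$ divides $|M_A|$.
   Context: $\mathcal{R}_p$ is the set of nonzero quadratic residues modulo $p$. $A-A\doteq S$ means: every element of $S$ has exactly one representation as $a'-a''$ with $a',a''\in A$, and every difference $a'-a''$ with $a'\ne a''$ in $A$ lies in $S$. An element $\mu\in\mathbb{F}_p^\times$ is a multiplier of $A\subseteq\mathbb{F}_p$ if there is $g\in\mathbb{F}_p$ with $\mu A=A+g$, where $\mu A=\{\mu a\colon a\in A\}$; the multipliers of $A$ form a subgroup $M_A$ of $\mathbb{F}_p^\times$ (the multiplier subgroup). For a prime $p\equiv1\pmod4$, $G_p:=\gcd\{\operatorname{ord}_p(q)\colon q \text{ prime},\ q\mid \tfrac{p-1}{4}\}$, where $\operatorname{ord}_p(q)$ is the multiplicative order of $q$ modulo $p$.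
   Formalization: For p = 5 no prime divides (p-1)/4, so G_p is a gcd of an empty family (undefined, or 0, for which the claim fails with A = {0,1}); here G_5 is taken to be 1. The remark that p ≡ 1 (mod 4), immediate from the hypothesis, is not restated. *)

theory Defs
  imports "HOL-Number_Theory.Number_Theory"
begin

definition Fp :: "nat \<Rightarrow> nat set" where
  "Fp p = {0..<p}"

definition Rp :: "nat \<Rightarrow> nat set" where
  "Rp p = {x. 0 < x \<and> x < p \<and> QuadRes (int p) (int x)}"

definition diffp :: "nat \<Rightarrow> nat \<Rightarrow> nat \<Rightarrow> nat" where
  "diffp p a1 a2 = (a1 + p - a2) mod p"

definition diff_rep :: "nat \<Rightarrow> nat set \<Rightarrow> nat set \<Rightarrow> bool" where
  "diff_rep p A S \<longleftrightarrow>
     (\<forall>s\<in>S. \<exists>!(a1, a2). a1 \<in> A \<and> a2 \<in> A \<and> diffp p a1 a2 = s) \<and>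
     (\<forall>a1\<in>A. \<forall>a2\<in>A. a1 \<noteq> a2 \<longrightarrow> diffp p a1 a2 \<in> S)"

definition multipliers :: "nat \<Rightarrow> nat set \<Rightarrow> nat set" where
  "multipliers p A = {mu. 0 < mu \<and> mu < p \<and>
     (\<exists>g\<in>Fp p. (\<lambda>a. (mu * a) mod p) ` A = (\<lambda>a. (a + g) mod p) ` A)}"

text \<open>G_p = gcd of ord_p(q) over primes q dividing (p-1)/4.
  Convention: the gcd over the empty family (p = 5) is taken to be 1.\<close>
definition Gp :: "nat \<Rightarrow> nat" where
  "Gp p = (if {q. prime q \<and> q dvd (p - 1) div 4} = {} then 1
           else Gcd ((\<lambda>q. ord p q) ` {q. prime q \<and> q dvd (p - 1) div 4}))"

end

theory Submission
  imports Defs "HOL-Computational_Algebra.Computational_Algebra"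
begin

text \<open>
  Work in the group ring of the cyclic group of order \<open>p\<close>, realised as integer polynomials modulo
  \<open>x ^ p - 1\<close>. Write \<open>a\<close>, \<open>r\<close>, \<open>s\<close>, \<open>g\<close> for the formal sums over \<open>A\<close>, the residues, the
  nonresidues and the whole group, a bar for \<open>x \<mapsto> x\<inverse>\<close>, and \<open>n = |A|\<close>, \<open>N = (p - 1) / 4\<close>. Then
  \<open>a \<cdot> bar a = n + r\<close>, and \<open>(n + r)(n + s) = N + (n + N) g\<close>, so that \<open>Y = bar a \<cdot> (n + s) - g\<close>
  satisfies \<open>a Y = N (1 + g)\<close>.

  If a prime power \<open>q ^ e\<close> divides a product \<open>X Y\<close> in the group ring, then it also divides
  \<open>X(x ^ q) Y\<close>: this is the elementary form of the fact that the Frobenius of \<open>q\<close> fixes the prime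
  ideals above \<open>q\<close> in the \<open>p\<close>-th cyclotomic field. Hence, if \<open>h\<close> is a power modulo \<open>p\<close> of every
  prime divisor of \<open>N\<close>, then \<open>N\<close> divides \<open>a(x ^ h) Y\<close>, and multiplying by \<open>a\<close> gives
  \<open>a(x ^ h) = V a\<close> for some \<open>V\<close> of augmentation \<open>1\<close>. If \<open>h\<close> is moreover a quadratic residue, then
  \<open>V \<cdot> bar V = 1\<close>; the constant coefficient shows that the squares of the coefficients of \<open>V\<close> sum to
  \<open>1\<close>, so \<open>V = x ^ j\<close>, that is \<open>h A = A + j\<close>.

  An element \<open>h\<close> of the subgroup of order \<open>G_p\<close> is a power of every prime \<open>q\<close> dividing \<open>N\<close>, since the
  unit group is cyclic, and every such \<open>q\<close> is a quadratic residue by quadratic reciprocity.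
\<close>

section \<open>Divisibility in the group ring of a cyclic group\<close>

definition cyc :: "nat \<Rightarrow> int poly" where
  "cyc p = monom 1 p - 1"

text \<open>
  \<open>gdvd p k X\<close>: the image of \<open>X\<close> in the group ring is divisible by \<open>k\<close>. The case \<open>k = 0\<close> says that
  this image vanishes.
\<close>

definition gdvd :: "nat \<Rightarrow> int \<Rightarrow> int poly \<Rightarrow> bool" where
  "gdvd p k X \<longleftrightarrow> (\<exists>U V. X = smult k U + cyc p * V)"

abbreviation subst_pow :: "int poly \<Rightarrow> nat \<Rightarrow> int poly" where
  "subst_pow X h \<equiv> pcompose X (monom 1 h)"

lemma gdvd_zero_iff: "gdvd p 0 X \<longleftrightarrow> cyc p dvd X"
  by (auto simp: gdvd_def dvd_def)

section \<open>Arithmetic of divisibility in the group ring\<close>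

lemma gdvd_0 [simp]: "gdvd p k 0"
  unfolding gdvd_def by (rule exI[of _ 0], rule exI[of _ 0]) simp

lemma gdvd_add: "gdvd p k X \<Longrightarrow> gdvd p k Y \<Longrightarrow> gdvd p k (X + Y)"
  unfolding gdvd_def
proof clarify
  fix U V U' V'
  show "\<exists>Ua Va. smult k U + cyc p * V + (smult k U' + cyc p * V') = smult k Ua + cyc p * Va"
    by (rule exI[of _ "U + U'"], rule exI[of _ "V + V'"]) (simp add: smult_add_right algebra_simps)
qed

lemma gdvd_mult:
  assumes "gdvd p j X" "gdvd p k Y"
  shows "gdvd p (j * k) (X * Y)"
proof -
  obtain U V U' V' where 1: "X = smult j U + cyc p * V" "Y = smult k U' + cyc p * V'"
    using assms unfolding gdvd_def by blast
  have "X * Y = smult (j * k) (U * U') + cyc p * (V * Y + V' * smult j U)"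
    unfolding 1 by (simp add: algebra_simps)
  then show ?thesis unfolding gdvd_def by blast
qed

lemma gdvd_one [simp]: "gdvd p 1 X"
  unfolding gdvd_def by (rule exI[of _ X], rule exI[of _ 0]) simp

lemma gdvd_multR: "gdvd p k X \<Longrightarrow> gdvd p k (X * Y)"
  using gdvd_mult[of p k X 1 Y] by simp

lemma gdvd_multL: "gdvd p k Y \<Longrightarrow> gdvd p k (X * Y)"
  using gdvd_mult[of p 1 X k Y] by simp

lemma gdvd_uminus: "gdvd p k X \<Longrightarrow> gdvd p k (- X)"
  using gdvd_multL[of p k X "-1"] by simp

lemma gdvd_uminus_iff: "gdvd p k (- X) \<longleftrightarrow> gdvd p k X"
  using gdvd_uminus[of p k X] gdvd_uminus[of p k "-X"] by auto

lemma gdvd_diff: "gdvd p k X \<Longrightarrow> gdvd p k Y \<Longrightarrow> gdvd p k (X - Y)"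
  using gdvd_add[of p k X "-Y"] gdvd_uminus[of p k Y] by simp

lemma gdvd_trans: "gdvd p k (X - Y) \<Longrightarrow> gdvd p k (Y - Z) \<Longrightarrow> gdvd p k (X - Z)"
  using gdvd_add[of p k "X - Y" "Y - Z"] by simp

lemma gdvd_sym: "gdvd p k (X - Y) \<Longrightarrow> gdvd p k (Y - X)"
  using gdvd_uminus[of p k "X - Y"] by simp

lemma gdvd_sum: "(\<And>i. i \<in> I \<Longrightarrow> gdvd p k (f i)) \<Longrightarrow> gdvd p k (sum f I)"
  by (induction I rule: infinite_finite_induct) (auto intro: gdvd_add)

lemma gdvd_cong_mult:
  "gdvd p k (X - X') \<Longrightarrow> gdvd p k (Y - Y') \<Longrightarrow> gdvd p k (X * Y - X' * Y')"
  using gdvd_add[OF gdvd_multR[of p k "X - X'" Y] gdvd_multL[of p k "Y - Y'" X']]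
  by (simp add: algebra_simps)

lemma gdvd_cong_power: "gdvd p k (X - Y) \<Longrightarrow> gdvd p k (X ^ n - Y ^ n)"
  by (induction n) (auto intro: gdvd_cong_mult)

lemma gdvd_smult: "gdvd p k X \<Longrightarrow> gdvd p (c * k) (smult c X)"
proof -
  assume "gdvd p k X"
  then obtain U V where "X = smult k U + cyc p * V" unfolding gdvd_def by blast
  then have "smult c X = smult (c * k) U + cyc p * smult c V"
    by (simp add: smult_add_right)
  then show ?thesis unfolding gdvd_def by blast
qed

lemma gdvd_smult_self: "gdvd p k (smult k X)"
  using gdvd_smult[of p 1 X k] by simp

lemma const_dvd_gdvd: "[:k:] dvd X \<Longrightarrow> gdvd p k X"
  using gdvd_smult_self by (auto elim!: dvdE)

lemma gdvd_dvd: "gdvd p k X \<Longrightarrow> j dvd k \<Longrightarrow> gdvd p j X"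
proof -
  assume "gdvd p k X" "j dvd k"
  then obtain U V c where "X = smult k U + cyc p * V" "k = j * c" unfolding gdvd_def by blast
  then have "X = smult j (smult c U) + cyc p * V" by simp
  then show ?thesis unfolding gdvd_def by blast
qed

lemma gdvd_from_zero: "gdvd p 0 X \<Longrightarrow> gdvd p k X"
  by (rule gdvd_dvd) auto

lemma lead_coeff_cyc: "p > 0 \<Longrightarrow> lead_coeff (cyc p) = 1 \<and> degree (cyc p) = p"
proof -
  assume p: "p > 0"
  have c: "coeff (cyc p) p = 1" using p by (simp add: cyc_def)
  have "degree (cyc p) = p"
  proof (rule antisym)
    show "degree (cyc p) \<le> p" unfolding cyc_def
      by (rule degree_diff_le) (auto simp: degree_monom_le)
    show "p \<le> degree (cyc p)" by (rule le_degree) (simp add: c)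
  qed
  then show ?thesis using c by simp
qed

lemma content_cyc: "p > 0 \<Longrightarrow> content (cyc p) = 1"
  using content_dvd_coeff[of "cyc p" p] lead_coeff_cyc[of p]
  by (metis is_unit_normalize normalize_content)

text \<open>The group ring is torsion-free. By Gauss's lemma, a constant dividing
  \<open>cyc p * V\<close> divides \<open>V\<close>, because the monic polynomial
  \<open>cyc p\<close> has content 1. With \<open>k = 0\<close> this cancels a nonzero integer from
  a relation.\<close>

lemma gdvd_cancel:
  assumes "p > 0" "c \<noteq> 0" "gdvd p (c * k) (smult c X)"
  shows "gdvd p k X"
proof -
  obtain U V where 1: "smult c X = smult (c * k) U + cyc p * V"
    using assms unfolding gdvd_def by blast
  then have "cyc p * V = [:c:] * (X - smult k U)" by (simp add: algebra_simps smult_diff_right)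
  then have "[:c:] dvd cyc p * V" by (metis dvd_triv_left)
  then have "c dvd content (cyc p * V)" by (simp only: const_poly_dvd_iff_dvd_content)
  then have "c dvd content V" using content_cyc[OF assms(1)] by (simp add: content_mult)
  then obtain W where "V = [:c:] * W" using const_poly_dvd_iff_dvd_content[of c V] by auto
  then have "smult c X = smult c (smult k U + cyc p * W)" using 1 by (simp add: smult_add_right)
  then have "X = smult k U + cyc p * W" using assms(2) by (metis smult_cancel)
  then show ?thesis unfolding gdvd_def by blast
qed

lemma gdvd_coprime:
  assumes "coprime j k" "gdvd p j X" "gdvd p k X"
  shows "gdvd p (j * k) X"
proof -
  obtain u v where uv: "u * j + v * k = 1"
    using assms(1) by (metis bezout_int coprime_imp_gcd_eq_1)
  have "gdvd p (j * k) (smult j X)" using gdvd_smult[OF assms(3), of j] .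
  then have a: "gdvd p (j * k) ([:u:] * smult j X)" by (rule gdvd_multL)
  have "gdvd p (j * k) (smult k X)" using gdvd_smult[OF assms(2), of k] by (simp add: mult.commute)
  then have b: "gdvd p (j * k) ([:v:] * smult k X)" by (rule gdvd_multL)
  have "[:u:] * smult j X + [:v:] * smult k X = smult (u * j + v * k) X"
    by (simp add: smult_add_left mult.commute)
  then show ?thesis using gdvd_add[OF a b] uv by simp
qed

section \<open>The substitutions of \<open>x ^ h\<close> for \<open>x\<close>\<close>

lemma pcompose_power: "pcompose (X ^ n) Y = pcompose X Y ^ n" for X :: "'a::comm_ring_1 poly"
  by (induction n) (auto simp: pcompose_mult pcompose_1)

lemma pcompose_monom: "pcompose (monom c n) Y = smult c (Y ^ n)" for Y :: "'a::comm_ring_1 poly"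
  by (simp add: monom_altdef pcompose_smult pcompose_power pcompose_pCons)

lemma subst_pow_monom: "subst_pow (monom c n) h = monom c (h * n)"
  by (simp add: pcompose_monom monom_power smult_monom)

lemma subst_pow_subst_pow: "subst_pow (subst_pow X h) k = subst_pow X (h * k)"
  by (simp add: pcompose_assoc[symmetric] subst_pow_monom mult.commute)

lemma subst_pow_1 [simp]: "subst_pow X (Suc 0) = X"
  by (simp add: monom_altdef)

lemma gdvd_monom_cong:
  assumes "[a = b] (mod p)"
  shows "gdvd p k (monom c a - monom c b)"
proof -
  have *: "cyc p dvd monom 1 (p * m) - 1" for m
    using power_diff_1_eq[of "monom 1 p :: int poly" m] by (simp add: cyc_def monom_power)
  have main: "gdvd p 0 (monom c (a + p * m) - monom c a)" for a m
  proof -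
    have "monom c (a + p * m) - monom c a = monom c a * (monom 1 (p * m) - 1)"
      by (simp add: algebra_simps mult_monom)
    then show ?thesis unfolding gdvd_zero_iff using * by simp
  qed
  obtain m n where "a + p * m = b + p * n"
    using assms by (metis cong_iff_lin_nat mult.commute)
  then have "gdvd p 0 (monom c a - monom c b)"
    using main[of a m] main[of b n] by (metis gdvd_sym gdvd_trans)
  then show ?thesis by (rule gdvd_from_zero)
qed

text \<open>This makes the substitution well defined on the group ring: \<open>x ^ p - 1\<close>
  divides \<open>x ^ (h * p) - 1\<close>.\<close>

lemma cyc_dvd_subst_pow_cyc: "cyc p dvd subst_pow (cyc p) h"
proof -
  have "subst_pow (cyc p) h = monom 1 (h * p) - monom 1 0"
    by (simp add: cyc_def pcompose_diff pcompose_1 subst_pow_monom)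
  also have "gdvd p 0 \<dots>" by (rule gdvd_monom_cong) (simp add: cong_def)
  finally show ?thesis by (simp add: gdvd_zero_iff)
qed

lemma gdvd_subst_pow:
  assumes "gdvd p k X"
  shows "gdvd p k (subst_pow X h)"
proof -
  obtain U V where "X = smult k U + cyc p * V" using assms unfolding gdvd_def by blast
  then have "subst_pow X h = smult k (subst_pow U h) + subst_pow (cyc p) h * subst_pow V h"
    by (simp add: pcompose_add pcompose_smult pcompose_mult)
  moreover have "gdvd p k (subst_pow (cyc p) h)"
    using cyc_dvd_subst_pow_cyc gdvd_zero_iff gdvd_from_zero by blast
  ultimately show ?thesis by (simp add: gdvd_add gdvd_smult_self gdvd_multR)
qed

lemma gdvd_subst_pow_cong:
  assumes "[a = b] (mod p)"
  shows "gdvd p k (subst_pow X a - subst_pow X b)"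
proof (induction X)
  case 0
  then show ?case by simp
next
  case (pCons c X)
  have "gdvd p k (monom 1 a * subst_pow X a - monom 1 b * subst_pow X b)"
    by (intro gdvd_cong_mult pCons gdvd_monom_cong assms)
  then show ?case by (simp add: pcompose_pCons)
qed

section \<open>Frobenius congruences modulo a prime and their lifts to prime powers\<close>

lemma const_dvd_freshman:
  assumes "prime q"
  shows "[:int q:] dvd (X + Y) ^ q - X ^ q - Y ^ q"
proof -
  have q: "q > 0" using assms prime_gt_0_nat by blast
  have "(X + Y) ^ q = (\<Sum>k\<le>q. of_nat (q choose k) * X ^ k * Y ^ (q - k))"
    by (rule binomial_ring)
  also have "{..q} = insert 0 (insert q {0<..<q})" using q by auto
  also have "(\<Sum>k\<in>\<dots>. of_nat (q choose k) * X ^ k * Y ^ (q - k)) =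
     Y ^ q + X ^ q + (\<Sum>k\<in>{0<..<q}. of_nat (q choose k) * X ^ k * Y ^ (q - k))"
    using q by simp
  finally have "(X + Y) ^ q - X ^ q - Y ^ q = (\<Sum>k\<in>{0<..<q}. of_nat (q choose k) * X ^ k * Y ^ (q - k))"
    by simp
  also have "[:int q:] dvd \<dots>"
  proof (intro dvd_sum dvd_mult2)
    fix k assume "k \<in> {0<..<q}"
    then have "q dvd q choose k" using assms by (intro dvd_choose_prime) auto
    then have "int q dvd int (q choose k)" by (simp only: int_dvd_int_iff)
    then show "[:int q:] dvd of_nat (q choose k)" by (simp add: of_nat_poly)
  qed
  finally show ?thesis .
qed

lemma fermat_int:
  assumes "prime q"
  shows "int q dvd a ^ q - a"
proof -
  define b where "b = nat (a mod int q)"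
  have q: "q > 0" using assms prime_gt_0_nat by blast
  have ab: "[a = int b] (mod int q)" unfolding b_def using q by (simp add: cong_def)
  have "[b ^ q = b] (mod q)"
  proof (cases "q dvd b")
    case True
    then have "[b ^ q = 0] (mod q)" "[b = 0] (mod q)"
      using q by (auto simp: cong_0_iff intro: dvd_trans[OF True dvd_power])
    then show ?thesis using cong_sym cong_trans by blast
  next
    case False
    then have "[b * b ^ (q - 1) = b * 1] (mod q)"
      by (intro cong_scalar_left fermat_theorem assms)
    then show ?thesis using q by (simp flip: power_Suc)
  qed
  then have "[int b ^ q = int b] (mod int q)" by (metis cong_int_iff of_nat_power)
  then have "[a ^ q = a] (mod int q)" using ab by (metis cong_pow cong_sym cong_trans)
  then show ?thesis by (simp add: cong_iff_dvd_diff)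
qed

text \<open>Induction on the coefficients: the binomial congruence separates the constant term from
  the rest, and Fermat's little theorem handles that constant.\<close>

lemma const_dvd_frobenius:
  assumes "prime q"
  shows "[:int q:] dvd X ^ q - subst_pow X q"
proof (induction X)
  case 0
  then show ?case using assms prime_gt_0_nat[of q] by (simp add: power_0_left)
next
  case (pCons a X)
  let ?x = "monom 1 1 :: int poly"
  have e: "pCons a X = [:a:] + ?x * X" by (simp add: monom_altdef)
  have 1: "[:int q:] dvd ([:a:] + ?x * X) ^ q - [:a:] ^ q - (?x * X) ^ q"
    by (rule const_dvd_freshman[OF assms])
  have 2: "[:int q:] dvd [:a:] ^ q - [:a:]"
    using fermat_int[OF assms, of a] by (simp add: poly_const_pow)
  have 3: "[:int q:] dvd monom 1 q * (X ^ q - subst_pow X q)"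
    using pCons(2) by (rule dvd_mult)
  have "(pCons a X) ^ q - subst_pow (pCons a X) q =
     (([:a:] + ?x * X) ^ q - [:a:] ^ q - (?x * X) ^ q) + ([:a:] ^ q - [:a:])
      + monom 1 q * (X ^ q - subst_pow X q)"
    by (simp add: e pcompose_add pcompose_mult subst_pow_monom algebra_simps power_mult_distrib monom_power
       del: pCons_one )
  then show ?case using dvd_add[OF dvd_add[OF 1 2] 3] by (simp only:)
qed

lemma gdvd_frobenius:
  assumes "prime q"
  shows "gdvd p (int q) (X ^ (q ^ m) - subst_pow X (q ^ m))"
proof (induction m)
  case 0
  then show ?case by simp
next
  case (Suc m)
  have "gdvd p (int q) ((X ^ (q ^ m)) ^ q - subst_pow X (q ^ m) ^ q)"
    by (rule gdvd_cong_power[OF Suc])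
  moreover have "gdvd p (int q) (subst_pow X (q ^ m) ^ q - subst_pow (subst_pow X (q ^ m)) q)"
    by (rule const_dvd_gdvd[OF const_dvd_frobenius[OF assms]])
  ultimately show ?case
    by (simp add: subst_pow_subst_pow power_mult[symmetric] mult.commute gdvd_trans)
qed

text \<open>In the factorisation of \<open>X ^ q - Y ^ q\<close> the cofactor of
  \<open>X - Y\<close> is a sum of \<open>q\<close> terms, each congruent to
  \<open>Y ^ (q - 1)\<close> modulo \<open>q\<close>; it contributes one more factor
  \<open>q\<close>.\<close>

lemma gdvd_power_lift:
  assumes "gdvd p (int q ^ Suc k) (X - Y)"
  shows "gdvd p (int q ^ Suc (Suc k)) (X ^ q - Y ^ q)"
proof -
  have 0: "gdvd p (int q) (X - Y)" by (rule gdvd_dvd[OF assms]) simp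
  have "X ^ q - Y ^ q = (X - Y) * (\<Sum>i<q. X ^ i * Y ^ (q - Suc i))"
    by (simp add: power_diff_sumr2 mult.commute)
  moreover have "gdvd p (int q) (\<Sum>i<q. X ^ i * Y ^ (q - Suc i))"
  proof -
    have "gdvd p (int q) (\<Sum>i<q. X ^ i * Y ^ (q - Suc i) - Y ^ i * Y ^ (q - Suc i))"
      by (intro gdvd_sum gdvd_cong_mult gdvd_cong_power 0) simp
    moreover have "(\<Sum>i<q. Y ^ i * Y ^ (q - Suc i)) = (\<Sum>i<q. Y ^ (q - 1))"
      by (intro sum.cong) (auto simp flip: power_add)
    ultimately have "gdvd p (int q) ((\<Sum>i<q. X ^ i * Y ^ (q - Suc i)) - smult (int q) (Y ^ (q - 1)))"
      by (simp add: sum_subtractf of_nat_poly)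
    from gdvd_add[OF this gdvd_smult_self[of p "int q" "Y ^ (q - 1)"]] show ?thesis by simp
  qed
  ultimately show ?thesis using gdvd_mult[OF assms, of "int q" "\<Sum>i<q. X ^ i * Y ^ (q - Suc i)"]
    by (simp add: mult_ac)
qed

lemma gdvd_power_lift_iter:
  assumes "gdvd p (int q) (X - Y)"
  shows "gdvd p (int q ^ Suc k) (X ^ (q ^ k) - Y ^ (q ^ k))"
proof (induction k)
  case 0
  then show ?case using assms by simp
next
  case (Suc k)
  from gdvd_power_lift[OF this] show ?case by (simp add: power_mult[symmetric] mult.commute)
qed

lemma gdvd_reduce_power:
  assumes "gdvd p k (X ^ Suc t - X)"
  shows "gdvd p k (X ^ Suc (t * j) - X)"
proof (induction j)
  case 0
  then show ?case by simp
next
  case (Suc j)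
  have "gdvd p k (X ^ t * (X ^ Suc (t * j) - X))" by (rule gdvd_multL[OF Suc])
  moreover have "X ^ t * (X ^ Suc (t * j) - X) = X ^ Suc (t * Suc j) - X ^ Suc t"
    by (simp add: algebra_simps power_add)
  ultimately show ?case using assms gdvd_trans by metis
qed

text \<open>Induction on \<open>e\<close>, treating \<open>X * E\<close> and
  \<open>X * (1 - E)\<close> separately for an approximate idempotent \<open>E\<close>. The first
  part is easy because \<open>E\<close> is a multiple of \<open>X\<close>; the second is
  \<open>q\<close> times some \<open>X1\<close>, and after cancelling \<open>q\<close> the induction
  hypothesis applies to \<open>X1\<close>.\<close>

lemma gdvd_frobenius_shift:
  assumes p: "p > 0" and q: "prime q" "coprime q p"
    and "gdvd p (int q ^ e) (X * Y)"
  shows "gdvd p (int q ^ e) (subst_pow X q * Y)"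
  using assms(4)
proof (induction e arbitrary: X)
  case 0
  then show ?case by simp
next
  case (Suc e)
  \<comment> \<open>By Euler's theorem the \<open>totient p\<close>-fold Frobenius acts as the
    identity on the group ring, so \<open>X ^ Suc t\<close> is congruent to \<open>X\<close> modulo
    \<open>q\<close>.\<close>
  define t where "t = q ^ totient p - 1"
  have t2: "q ^ totient p \<ge> 2"
    using q(1) p prime_ge_2_nat[of q] totient_gt_0_iff[of p]
    by (metis le_trans self_le_power Suc_leI one_le_numeral)
  then have t: "t > 0" "q ^ totient p = Suc t" unfolding t_def by auto
  have cong: "[q ^ totient p = 1] (mod p)" using euler_theorem[OF q(2)] .
  have red: "gdvd p (int q) (X ^ Suc t - X)"
    using gdvd_trans[OF gdvd_frobenius[OF q(1), of p X "totient p"] gdvd_subst_pow_cong[OF cong]]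
    by (simp add: t)
  \<comment> \<open>Modulo \<open>q ^ Suc e\<close>, \<open>E\<close> is the idempotent of the part of the ring in which \<open>X\<close> is invertible modulo
    \<open>q\<close>: \<open>E\<close> is a multiple of \<open>X\<close>, \<open>X (1 - E)\<close> is divisible by \<open>q\<close>, and \<open>E\<close> is fixed by the substitution.\<close>
  define E where "E = (X ^ t) ^ (q ^ e)"
  obtain E' where E': "E = X * E'"
  proof -
    have "X dvd E" unfolding E_def using t q(1) prime_gt_0_nat[of q] by (auto simp flip: power_mult intro!: dvd_power)
    then show ?thesis using that by blast
  qed
  have sub: "subst_pow (X * (1 - E)) q * Y = subst_pow X q * (1 - subst_pow E q) * Y"
    by (simp add: pcompose_mult pcompose_diff pcompose_1)
  have A: "gdvd p (int q ^ Suc e) (subst_pow X q * Y * E)"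
    using gdvd_multR[OF Suc.prems, of "E' * subst_pow X q"] unfolding E' by (simp add: mult_ac)
  \<comment> \<open>Modulo \<open>q\<close> the substitution is the \<open>q\<close>-th power, which
    fixes \<open>X ^ t\<close> as \<open>X ^ Suc t\<close> is congruent to \<open>X\<close>. Raising
    to the power \<open>q ^ e\<close> lifts the congruence to \<open>q ^ Suc e\<close>.\<close>
  have B: "gdvd p (int q ^ Suc e) (subst_pow E q - E)"
  proof -
    have "gdvd p (int q) (subst_pow (X ^ t) q - X ^ t)"
    proof -
      have "gdvd p (int q) (subst_pow (X ^ t) q - (X ^ t) ^ q)"
        using gdvd_sym[OF const_dvd_gdvd[OF const_dvd_frobenius[OF q(1)]]] .
      moreover have "gdvd p (int q) (X ^ (t - 1) * (X ^ Suc (t * (q - 1)) - X))"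
        by (rule gdvd_multL[OF gdvd_reduce_power[OF red]])
      moreover have "X ^ (t - 1) * (X ^ Suc (t * (q - 1)) - X) = (X ^ t) ^ q - X ^ t"
      proof -
        have "X ^ (t - 1) * X ^ Suc (t * (q - 1)) = X ^ (t - 1 + Suc (t * (q - 1)))"
          by (simp only: power_add)
        also have "t - 1 + Suc (t * (q - 1)) = t * q"
          using t q(1) prime_gt_0_nat[of q] by (cases q) auto
        finally have "X ^ (t - 1) * X ^ Suc (t * (q - 1)) = (X ^ t) ^ q" by (simp add: power_mult)
        moreover have "X ^ (t - 1) * X = X ^ t" using t(1) by (simp add: power_eq_if[of X t] mult.commute)
        ultimately show ?thesis by (simp only: right_diff_distrib)
      qed
      ultimately show ?thesis by (metis gdvd_trans)
    qed
    from gdvd_power_lift_iter[OF this] show ?thesis unfolding E_def by (simp add: pcompose_power)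
  qed
  have C: "gdvd p (int q) (X * (1 - E))"
  proof -
    have "X * (1 - E) = - (X ^ Suc (t * q ^ e) - X)" by (simp add: E_def algebra_simps flip: power_mult)
    then show ?thesis using gdvd_reduce_power[OF red, of "q ^ e"] by (simp only: gdvd_uminus_iff)
  qed
  then obtain X1 V where X1: "X * (1 - E) = smult (int q) X1 + cyc p * V" unfolding gdvd_def by blast
  have cycd: "gdvd p k (cyc p * Z)" for k Z by (rule gdvd_from_zero) (simp add: gdvd_zero_iff)
  \<comment> \<open>Discarding the multiple of \<open>cyc p\<close> leaves
    \<open>smult (int q) (X1 * Y)\<close>, from which one factor \<open>q\<close> is
    cancelled.\<close>
  have "gdvd p (int q ^ Suc e) (X * Y * (1 - E) - cyc p * (V * Y))"
    by (intro gdvd_diff gdvd_multR Suc.prems cycd)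
  also have "X * Y * (1 - E) - cyc p * (V * Y) = smult (int q) (X1 * Y)"
  proof -
    have "X * Y * (1 - E) = (X * (1 - E)) * Y" by (simp add: mult_ac)
    also have "\<dots> = smult (int q) (X1 * Y) + cyc p * (V * Y)" unfolding X1 by (simp add: algebra_simps)
    finally show ?thesis by simp
  qed
  finally have "gdvd p (int q ^ e) (X1 * Y)"
    using gdvd_cancel[OF p, of "int q" "int q ^ e"] q(1) prime_gt_0_nat[of q] by simp
  then have "gdvd p (int q ^ e) (subst_pow X1 q * Y)" by (rule Suc.IH)
  then have "gdvd p (int q ^ Suc e) (smult (int q) (subst_pow X1 q * Y))"
    using gdvd_smult by simp
  moreover have "gdvd p (int q ^ Suc e) (subst_pow (cyc p * V) q * Y)"
    by (intro gdvd_multR gdvd_subst_pow cycd)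
  ultimately have "gdvd p (int q ^ Suc e) (subst_pow (X * (1 - E)) q * Y)"
    unfolding X1 using gdvd_add by (simp add: pcompose_add pcompose_smult algebra_simps)
  then have D: "gdvd p (int q ^ Suc e) (subst_pow X q * (1 - subst_pow E q) * Y)"
    unfolding sub .
  \<comment> \<open>\<open>D\<close> involves the substituted \<open>E\<close> but \<open>A\<close>
    the original one; this term bridges the two.\<close>
  have "gdvd p (int q ^ Suc e) (subst_pow X q * Y * (subst_pow E q - E))" by (rule gdvd_multL[OF B])
  from gdvd_add[OF gdvd_add[OF D this] A] show ?case by (simp add: algebra_simps)
qed

lemma gdvd_frobenius_shift_iter:
  assumes p: "p > 0" and q: "prime q" "coprime q p"
    and "gdvd p (int q ^ e) (X * Y)"
  shows "gdvd p (int q ^ e) (subst_pow X (q ^ s) * Y)"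
proof (induction s)
  case 0
  then show ?case using assms by simp
next
  case (Suc s)
  from gdvd_frobenius_shift[OF p q this] show ?case
    by (simp add: subst_pow_subst_pow mult.commute)
qed

lemma gdvd_from_prime_powers:
  fixes N :: nat
  assumes "N > 0" "\<And>q e. prime q \<Longrightarrow> q ^ e dvd N \<Longrightarrow> gdvd p (int q ^ e) X"
  shows "gdvd p (int N) X"
  using assms
proof (induction N rule: less_induct)
  case (less N)
  show ?case
  proof (cases "N = 1")
    case True
    then show ?thesis by simp
  next
    case False
    then obtain q where q: "prime q" "q dvd N" using prime_factor_nat by blast
    define e where "e = multiplicity q N"
    obtain M where M: "N = q ^ e * M" "\<not> q dvd M"
      using multiplicity_decompose'[of N q] less.prems(1) q unfolding e_def
      by (metis not_prime_unit not_gr_zero)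
    have e: "e > 0" unfolding e_def using q less.prems(1)
      by (simp add: prime_multiplicity_gt_zero_iff)
    have "M > 0" using M less.prems(1) by (cases M) auto
    moreover have "M < N"
    proof -
      have "q ^ e > 1" using q(1) e prime_gt_1_nat one_less_power by blast
      then show ?thesis using M(1) \<open>M > 0\<close> by simp
    qed
    ultimately have "gdvd p (int M) X"
      by (intro less.IH) (auto intro!: less.prems(2) simp: M(1))
    moreover have "gdvd p (int q ^ e) X" using q M(1) by (intro less.prems(2)) auto
    moreover have "coprime (int q ^ e) (int M)"
      using q(1) M(2) by (simp add: prime_imp_coprime coprime_int_iff)
    ultimately have "gdvd p (int q ^ e * int M) X" by (intro gdvd_coprime)
    then show ?thesis using M(1) by simp
  qed
qed

section \<open>Formal sums\<close>

definition gen :: "nat set \<Rightarrow> int poly" where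
  "gen S = (\<Sum>s\<in>S. monom 1 s)"

lemma coeff_gen: "finite S \<Longrightarrow> coeff (gen S) i = (if i \<in> S then 1 else 0)"
  by (simp add: gen_def coeff_sum)

lemma poly_gen_1: "poly (gen S) 1 = int (card S)"
  by (simp add: gen_def poly_sum poly_monom)

lemma poly_1_gdvd: "gdvd p 0 X \<Longrightarrow> poly X 1 = 0"
  by (auto simp: gdvd_zero_iff cyc_def poly_monom elim!: dvdE)

lemma poly_subst_pow_1: "poly (subst_pow X h) 1 = poly X 1"
  by (simp add: poly_pcompose poly_monom)

text \<open>Multiplication by \<open>x\<close> permutes the whole group, so the sum over the group
  absorbs any factor up to its augmentation \<open>poly X 1\<close>.\<close>

lemma gdvd_mult_gen_all:
  assumes "p > 0"
  shows "gdvd p 0 (X * gen {..<p} - smult (poly X 1) (gen {..<p}))"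
proof (induction X)
  case 0
  then show ?case by simp
next
  case (pCons a X)
  let ?g = "gen {..<p}"
  have "monom 1 1 * ?g = (\<Sum>s<p. monom 1 (Suc s))"
    by (simp add: gen_def sum_distrib_left mult_monom)
  also have "\<dots> - ?g = cyc p"
    unfolding gen_def cyc_def sum_subtractf[symmetric] by (subst sum_lessThan_telescope) simp
  finally have 1: "gdvd p 0 (monom 1 1 * ?g - ?g)" by (simp add: gdvd_zero_iff)
  have "pCons a X * ?g - smult (poly (pCons a X) 1) ?g =
      monom 1 1 * (X * ?g - smult (poly X 1) ?g) + [:poly X 1:] * (monom 1 1 * ?g - ?g)"
    by (simp add: monom_altdef smult_add_left smult_diff_right)
  then show ?case using gdvd_add[OF gdvd_multL[OF pCons(2)] gdvd_multL[OF 1]] by (simp only:)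
qed

lemma gdvd_sum_cong:
  "(\<And>i. i \<in> I \<Longrightarrow> gdvd p k (f i - g i)) \<Longrightarrow> gdvd p k (sum f I - sum g I)"
  unfolding sum_subtractf[symmetric] by (rule gdvd_sum)

lemma gdvd_gen_image:
  assumes "inj_on f S" "\<And>s. s \<in> S \<Longrightarrow> [g s = f s] (mod p)"
  shows "gdvd p k ((\<Sum>s\<in>S. monom 1 (g s)) - gen (f ` S))"
  unfolding gen_def using assms
  by (subst sum.reindex) (auto intro!: gdvd_sum_cong gdvd_monom_cong)

lemma inj_on_mult_mod:
  fixes h p :: nat
  assumes "coprime h p" "S \<subseteq> {..<p}"
  shows "inj_on (\<lambda>s. h * s mod p) S"
proof (rule inj_onI)
  fix x y assume xy: "x \<in> S" "y \<in> S" and "h * x mod p = h * y mod p"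
  then have "[x = y] (mod p)" using assms(1) cong_mult_lcancel_nat[of h p x y] by (simp add: cong_def)
  then show "x = y" using assms(2) xy by (auto simp: cong_def subset_iff)
qed

lemma inj_on_add_mod:
  fixes j p :: nat
  assumes "S \<subseteq> {..<p}"
  shows "inj_on (\<lambda>s. (s + j) mod p) S"
proof (rule inj_onI)
  fix x y assume xy: "x \<in> S" "y \<in> S" and "(x + j) mod p = (y + j) mod p"
  then have "[x = y] (mod p)" using cong_add_rcancel_nat[of x j y p] by (simp add: cong_def)
  then show "x = y" using assms xy by (auto simp: cong_def subset_iff)
qed

lemma gdvd_subst_pow_gen:
  assumes "coprime h p" "S \<subseteq> {..<p}"
  shows "gdvd p k (subst_pow (gen S) h - gen ((\<lambda>s. h * s mod p) ` S))"
  using gdvd_gen_image[OF inj_on_mult_mod[OF assms], of "\<lambda>s. h * s" p k]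
  by (simp add: gen_def pcompose_sum subst_pow_monom)

lemma gdvd_monom_mult_gen:
  assumes "S \<subseteq> {..<p}"
  shows "gdvd p k (monom 1 j * gen S - gen ((\<lambda>s. (s + j) mod p) ` S))"
  using gdvd_gen_image[OF inj_on_add_mod[OF assms, of j], of "\<lambda>s. s + j" p k]
  by (simp add: gen_def sum_distrib_left mult_monom add.commute)

section \<open>Reduced representatives and units \<open>V\<close> with
  \<open>V * bar V = 1\<close>\<close>

lemma gdvd_zero_eq:
  assumes "p > 0" "gdvd p 0 (X - Y)" "degree X < p" "degree Y < p"
  shows "X = Y"
proof -
  have "degree (X - Y) < degree (cyc p)"
    using lead_coeff_cyc[OF assms(1)] degree_diff_less[OF assms(3,4)] by simp
  then have "X - Y = 0" using assms(2) dvd_imp_degree_le[of "cyc p" "X - Y"]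
    by (auto simp: gdvd_zero_iff)
  then show ?thesis by simp
qed

lemma degree_sum_less_monom:
  assumes "p > 0" "\<And>i. i \<in> I \<Longrightarrow> e i < p"
  shows "degree (\<Sum>i\<in>I. monom (c i) (e i)) < p"
proof -
  have "degree (\<Sum>i\<in>I. monom (c i) (e i)) \<le> p - 1"
  proof (cases "finite I")
    case True
    then show ?thesis using assms
      by (intro degree_sum_le) (force intro!: order.trans[OF degree_monom_le])+
  qed auto
  then show ?thesis using assms(1) by simp
qed

lemma degree_gen: "p > 0 \<Longrightarrow> S \<subseteq> {..<p} \<Longrightarrow> degree (gen S) < p"
  unfolding gen_def by (rule degree_sum_less_monom) auto

lemma gen_eq_iff:
  assumes "finite S" "finite T"
  shows "gen S = gen T \<longleftrightarrow> S = T"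
proof
  assume "gen S = gen T"
  moreover have "S = {i. coeff (gen S) i = 1}" "T = {i. coeff (gen T) i = 1}"
    by (auto simp: coeff_gen assms)
  ultimately show "S = T" by simp
qed auto

lemma gdvd_reduce:
  assumes "p > 0"
  obtains w where "gdvd p 0 (X - (\<Sum>i<p. monom (w i) i))"
proof -
  let ?W = "\<Sum>i\<le>degree X. monom (coeff X i) (i mod p)"
  have "X = (\<Sum>i\<le>degree X. monom (coeff X i) i)" by (simp add: poly_as_sum_of_monoms)
  moreover have "gdvd p 0 ((\<Sum>i\<le>degree X. monom (coeff X i) i) - ?W)"
    by (intro gdvd_sum_cong gdvd_monom_cong) (simp add: cong_def)
  moreover have "?W = (\<Sum>i<p. monom (coeff ?W i) i)"
  proof -
    have "degree ?W \<le> p - 1" using degree_sum_less_monom[OF assms, of "{..degree X}" "\<lambda>i. i mod p" "coeff X"] assms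
      by simp
    from poly_as_sum_of_monoms'[OF this] have "?W = (\<Sum>i\<le>p - 1. monom (coeff ?W i) i)" by simp
    also have "{..p - 1} = {..<p}" using assms by auto
    finally show ?thesis .
  qed
  ultimately show ?thesis using that[of "coeff ?W"] by simp
qed

text \<open>A nonzero integer has square at least 1, so only one \<open>w j\<close> can be nonzero;
  the plain sum fixes its sign.\<close>

lemma sum_power2_eq_1_int:
  fixes w :: "nat \<Rightarrow> int"
  assumes "finite I" "(\<Sum>i\<in>I. (w i)\<^sup>2) = 1" "(\<Sum>i\<in>I. w i) = 1"
  obtains j where "j \<in> I" "\<And>i. i \<in> I \<Longrightarrow> w i = (if i = j then 1 else 0)"
proof -
  obtain j where j: "j \<in> I" "w j \<noteq> 0" using assms(3) by (metis sum.neutral zero_neq_one)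
  have "(w j)\<^sup>2 \<ge> 1" using j by (metis int_one_le_iff_zero_less zero_less_power2)
  moreover have s: "(\<Sum>i\<in>I. (w i)\<^sup>2) = (w j)\<^sup>2 + (\<Sum>i\<in>I - {j}. (w i)\<^sup>2)"
    using assms(1) j(1) by (rule sum.remove)
  moreover have "(\<Sum>i\<in>I - {j}. (w i)\<^sup>2) \<ge> 0" by (rule sum_nonneg) simp
  ultimately have "(\<Sum>i\<in>I - {j}. (w i)\<^sup>2) = 0" using assms(2) by linarith
  then have z: "\<And>i. i \<in> I - {j} \<Longrightarrow> w i = 0"
    using assms(1) by (subst (asm) sum_nonneg_eq_0_iff) auto
  have "(\<Sum>i\<in>I. w i) = w j + (\<Sum>i\<in>I - {j}. w i)" using assms(1) j(1) by (rule sum.remove)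
  then have "w j = 1" using assms(3) z by simp
  then show ?thesis using that j z by fastforce
qed

text \<open>The factor \<open>p - 1\<close> stands for -1, so the exponent represents
  \<open>i - j\<close> without leaving the natural numbers.\<close>

lemma cong_opp_diff:
  assumes "(i::nat) < p" "j < p"
  shows "(i + (p - 1) * j) mod p = 0 \<longleftrightarrow> i = j"
proof -
  have "[i + (p - 1) * j = 0] (mod p) \<longleftrightarrow> [i + (p - 1) * j + j = 0 + j] (mod p)"
    by (rule cong_add_rcancel_nat[symmetric])
  also have "i + (p - 1) * j + j = i + p * j" using assms by (cases p) auto
  also have "[i + p * j = 0 + j] (mod p) \<longleftrightarrow> i = j" using assms by (simp add: cong_def)
  finally show ?thesis by (simp add: cong_def)
qed

lemma orthogonal_unit_is_monom:
  assumes p: "p > 0" and V: "gdvd p 0 (V * subst_pow V (p - 1) - 1)" "poly V 1 = 1"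
  obtains j where "j < p" "gdvd p 0 (V - monom 1 j)"
proof -
  obtain w where w: "gdvd p 0 (V - (\<Sum>i<p. monom (w i) i))" using gdvd_reduce[OF p] .
  define W where "W = (\<Sum>i<p. monom (w i) i)"
  have VW: "gdvd p 0 (V - W)" using w by (simp add: W_def)
  have "subst_pow V (p - 1) - subst_pow W (p - 1) = subst_pow (V - W) (p - 1)"
    by (simp add: pcompose_diff)
  then have "gdvd p 0 (V * subst_pow V (p - 1) - W * subst_pow W (p - 1))"
    using gdvd_subst_pow[OF VW] by (intro gdvd_cong_mult VW) simp
  then have 1: "gdvd p 0 (W * subst_pow W (p - 1) - 1)" using V(1) gdvd_trans gdvd_sym by blast
  \<comment> \<open>\<open>Z\<close> is the product of \<open>W\<close> and its conjugate with
    exponents reduced. Its degree is below \<open>p\<close>, so it equals 1 as a polynomial, and its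
    constant coefficient collects exactly the pairs with \<open>i = j\<close>.\<close>
  define Z where "Z = (\<Sum>(i, j)\<in>{..<p} \<times> {..<p}. monom (w i * w j) ((i + (p - 1) * j) mod p))"
  have "W * subst_pow W (p - 1) = (\<Sum>(i, j)\<in>{..<p} \<times> {..<p}. monom (w i * w j) (i + (p - 1) * j))"
    unfolding W_def by (simp add: pcompose_sum subst_pow_monom sum_product mult_monom sum.cartesian_product)
  then have "gdvd p 0 (W * subst_pow W (p - 1) - Z)" unfolding Z_def
    by (auto intro!: gdvd_sum_cong gdvd_monom_cong simp: cong_def)
  then have "gdvd p 0 (Z - 1)" using 1 gdvd_trans gdvd_sym by blast
  moreover have "degree Z < p"
    unfolding Z_def case_prod_unfold by (rule degree_sum_less_monom[OF p]) (use p in auto)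
  ultimately have "Z = 1" using p by (intro gdvd_zero_eq) auto
  have "coeff Z 0 = (\<Sum>(i, j)\<in>{..<p} \<times> {..<p}. if i = j then w i * w j else 0)"
    unfolding Z_def coeff_sum case_prod_unfold
    by (intro sum.cong refl) (auto simp only: mem_Sigma_iff lessThan_iff cong_opp_diff coeff_monom split_beta fst_conv snd_conv)
  also have "\<dots> = (\<Sum>i<p. \<Sum>j<p. if i = j then w i * w j else 0)"
    by (simp only: sum.cartesian_product)
  also have "\<dots> = (\<Sum>i<p. (w i)\<^sup>2)" by (simp add: power2_eq_square)
  finally have sq: "(\<Sum>i<p. (w i)\<^sup>2) = 1" using \<open>Z = 1\<close> by simp
  have "poly W 1 = 1" using poly_1_gdvd[OF VW] V(2) by simp
  then have "(\<Sum>i<p. w i) = 1" by (simp add: W_def poly_sum poly_monom)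
  then obtain j where j: "j < p" "\<And>i. i < p \<Longrightarrow> w i = (if i = j then 1 else 0)"
    using sum_power2_eq_1_int[OF _ sq] by auto
  have "W = (\<Sum>i<p. if i = j then monom 1 i else 0)" unfolding W_def
    by (intro sum.cong) (auto simp: j)
  then have "W = monom 1 j" using j(1) by simp
  then show ?thesis using that j(1) VW by simp
qed

section \<open>Residues and nonresidues\<close>

lemma QuadRes_cong: "[a = b] (mod p) \<Longrightarrow> QuadRes p a \<longleftrightarrow> QuadRes p b"
  unfolding QuadRes_def using cong_trans cong_sym by blast

lemma QuadRes_mod: "QuadRes (int p) (int (x mod p)) \<longleftrightarrow> QuadRes (int p) (int x)"
  by (rule QuadRes_cong) (simp add: cong_def zmod_int)

text \<open>Euler's criterion gives the identity modulo \<open>p\<close>. Both sides lie between -1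
  and 1, so their difference is less than \<open>p\<close> in absolute value.\<close>

lemma Legendre_mult:
  assumes "prime p" "2 < p"
  shows "Legendre (a * b) (int p) = Legendre a (int p) * Legendre b (int p)"
proof -
  have "[Legendre (a * b) (int p) = Legendre a (int p) * Legendre b (int p)] (mod int p)"
  proof -
    have "[Legendre (a * b) (int p) = a ^ ((p - 1) div 2) * b ^ ((p - 1) div 2)] (mod int p)"
      using euler_criterion[OF assms, of "a * b"] by (simp add: power_mult_distrib)
    also have "[a ^ ((p - 1) div 2) * b ^ ((p - 1) div 2) = Legendre a (int p) * Legendre b (int p)] (mod int p)"
      by (intro cong_mult cong_sym[OF euler_criterion[OF assms]])
    finally show ?thesis .
  qed
  then have "int p dvd Legendre (a * b) (int p) - Legendre a (int p) * Legendre b (int p)"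
    by (simp add: cong_iff_dvd_diff)
  moreover have "\<bar>Legendre (a * b) (int p) - Legendre a (int p) * Legendre b (int p)\<bar> < int p"
  proof -
    have "Legendre x (int p) \<in> {-1, 0, 1}" for x by (simp add: Legendre_def)
    from this[of "a * b"] this[of a] this[of b] show ?thesis
      using assms(2) unfolding insert_iff empty_iff by (elim disjE FalseE) simp_all
  qed
  ultimately show ?thesis
    using dvd_imp_le_int[of "Legendre (a * b) (int p) - Legendre a (int p) * Legendre b (int p)" "int p"]
    by linarith
qed

lemma QuadRes_mult_iff:
  assumes "prime p" "2 < p" "\<not> p dvd x" "\<not> p dvd y"
  shows "QuadRes (int p) (int (x * y)) \<longleftrightarrow> (QuadRes (int p) (int x) \<longleftrightarrow> QuadRes (int p) (int y))"
proof -
  have "\<not> p dvd x * y" using assms by (simp add: prime_dvd_mult_iff)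
  then have "\<not> [int x = 0] (mod int p)" "\<not> [int y = 0] (mod int p)" "\<not> [int (x * y) = 0] (mod int p)"
    using assms(3,4) by (auto simp: cong_0_iff simp del: of_nat_mult)
  then show ?thesis using Legendre_mult[OF assms(1,2), of "int x" "int y"]
    by (auto simp: Legendre_def split: if_splits)
qed

lemma finite_Rp [simp]: "finite (Rp p)"
  by (rule finite_subset[of _ "{..<p}"]) (auto simp: Rp_def)

text \<open>Of the two square roots \<open>z\<close> and \<open>p - z\<close> of a residue exactly
  one lies in the lower half \<open>{1..k}\<close>, so squaring maps this half bijectively onto the
  residues.\<close>

lemma card_Rp:
  assumes "prime p" "2 < p"
  shows "card (Rp p) = (p - 1) div 2"
proof -
  obtain k where odd: "p = 2 * k + 1" using prime_odd_nat[of p] assms by (auto elim!: oddE)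
  have "bij_betw (\<lambda>x. x\<^sup>2 mod p) {1..k} (Rp p)"
    unfolding bij_betw_def
  proof
    show "inj_on (\<lambda>x. x\<^sup>2 mod p) {1..k}"
    proof (rule inj_onI)
      fix x y assume x: "x \<in> {1..k}" and y: "y \<in> {1..k}" and eq: "x\<^sup>2 mod p = y\<^sup>2 mod p"
      have "[int x ^ 2 = int y ^ 2] (mod int p)"
        using eq by (metis cong_def cong_int_iff of_nat_power)
      then have "int p dvd (int x - int y) * (int x + int y)"
        by (simp add: cong_iff_dvd_diff power2_eq_square algebra_simps)
      then have "int p dvd int x - int y \<or> int p dvd int (x + y)"
        using assms(1) by (simp add: prime_dvd_mult_iff)
      moreover have "\<not> p dvd x + y" using x y odd by (intro nat_dvd_not_less) auto
      ultimately have "int p dvd int x - int y" by (simp only: int_dvd_int_iff) blast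
      moreover have "\<bar>int x - int y\<bar> < int p" using x y odd by auto
      ultimately show "x = y" using dvd_imp_le_int[of "int x - int y" "int p"] by linarith
    qed
    show "(\<lambda>x. x\<^sup>2 mod p) ` {1..k} = Rp p"
    proof (intro equalityI subsetI)
      fix r assume "r \<in> (\<lambda>x. x\<^sup>2 mod p) ` {1..k}"
      then obtain x where x: "x \<in> {1..k}" "r = x\<^sup>2 mod p" by blast
      have "\<not> p dvd x" using x odd by (intro nat_dvd_not_less) auto
      then have "\<not> p dvd x\<^sup>2" using assms(1) prime_dvd_power by blast
      then have "r > 0" using x by (simp add: dvd_eq_mod_eq_0)
      moreover have "QuadRes (int p) (int (x\<^sup>2))" unfolding QuadRes_def by (metis cong_refl of_nat_power)
      ultimately show "r \<in> Rp p" using x assms by (simp add: Rp_def QuadRes_mod del: of_nat_power)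
    next
      fix r assume r: "r \<in> Rp p"
      then obtain y where y: "[y\<^sup>2 = int r] (mod int p)" by (auto simp: Rp_def QuadRes_def)
      define z where "z = nat (y mod int p)"
      have z: "int z = y mod int p" "z < p" using assms unfolding z_def by (auto simp: nat_less_iff)
      have zr: "z\<^sup>2 mod p = r"
      proof -
        have "[int z ^ 2 = int r] (mod int p)" unfolding z(1) using y by (simp add: cong_def power_mod)
        then have "[z\<^sup>2 = r] (mod p)" by (metis cong_int_iff of_nat_power)
        then show ?thesis using r by (simp add: cong_def Rp_def)
      qed
      have "z > 0" using zr r by (auto simp: Rp_def intro: Nat.gr0I)
      show "r \<in> (\<lambda>x. x\<^sup>2 mod p) ` {1..k}"
      proof (cases "z \<le> k")
        case True
        then show ?thesis using zr \<open>z > 0\<close> by force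
      next
        case False
        have "int ((p - z)\<^sup>2) = int (z\<^sup>2) + int p * (int p - 2 * int z)"
          unfolding of_nat_power of_nat_diff[OF less_imp_le[OF z(2)]]
          by (simp add: power2_eq_square algebra_simps)
        then have "int ((p - z)\<^sup>2) mod int p = int (z\<^sup>2) mod int p" by (simp only: mod_mult_self2)
        then have "(p - z)\<^sup>2 mod p = r" using zr by (metis of_nat_eq_iff zmod_int)
        moreover have "p - z \<in> {1..k}" using False z(2) odd by auto
        ultimately show ?thesis by force
      qed
    qed
  qed
  from bij_betw_same_card[OF this] show ?thesis using odd by simp
qed

lemma coprime_less_prime:
  assumes "prime p" "x \<in> {0<..<p}"
  shows "coprime x (p::nat)"
proof -
  have "\<not> p dvd x" using assms(2) by (auto dest: nat_dvd_not_less)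
  then show ?thesis using assms(1) prime_imp_coprime coprime_commute by blast
qed

section \<open>Sums of a residue and a nonresidue\<close>

definition Np :: "nat \<Rightarrow> nat set" where
  "Np p = {x. 0 < x \<and> x < p \<and> \<not> QuadRes (int p) (int x)}"

lemma Rp_Un_Np: "Rp p \<union> Np p = {0<..<p}" "Rp p \<inter> Np p = {}"
  by (auto simp: Rp_def Np_def)

lemma finite_Np [simp]: "finite (Np p)"
  by (rule finite_subset[of _ "{..<p}"]) (auto simp: Np_def)

lemma card_Np:
  assumes "prime p" "2 < p"
  shows "card (Np p) = p - 1 - (p - 1) div 2"
proof -
  have "card (Rp p) + card (Np p) = p - 1"
    using card_Un_disjoint[OF finite_Rp finite_Np Rp_Un_Np(2)] by (simp add: Rp_Un_Np(1))
  then show ?thesis using card_Rp[OF assms] by simp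
qed

lemma mult_mod_Rp_Np:
  assumes "prime p" "2 < p" "u \<in> {0<..<p}" "x \<in> {0<..<p}"
  shows "u * x mod p \<in> Rp p \<longleftrightarrow> (u \<in> Rp p \<longleftrightarrow> x \<in> Rp p)"
    and "u * x mod p \<in> Np p \<longleftrightarrow> (u \<in> Rp p \<longleftrightarrow> x \<in> Np p)"
proof -
  have nd: "\<not> p dvd u" "\<not> p dvd x" using assms(3,4) by (auto dest: nat_dvd_not_less)
  then have "u * x mod p > 0" "u * x mod p < p"
    using assms(1,2) by (auto simp: prime_dvd_mult_iff simp flip: dvd_eq_mod_eq_0 intro!: Nat.gr0I)
  then show "u * x mod p \<in> Rp p \<longleftrightarrow> (u \<in> Rp p \<longleftrightarrow> x \<in> Rp p)"
    and "u * x mod p \<in> Np p \<longleftrightarrow> (u \<in> Rp p \<longleftrightarrow> x \<in> Np p)"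
    using assms(3,4) QuadRes_mult_iff[OF assms(1,2) nd]
    by (auto simp: Rp_def Np_def QuadRes_mod simp del: of_nat_mult)
qed

definition rn_count :: "nat \<Rightarrow> nat \<Rightarrow> nat" where
  "rn_count p t = card {(r, s). r \<in> Rp p \<and> s \<in> Np p \<and> (r + s) mod p = t}"

lemma finite_rn: "finite {(r, s). r \<in> Rp p \<and> s \<in> Np p \<and> (r + s) mod p = t}"
  by (rule finite_subset[of _ "Rp p \<times> Np p"]) auto

text \<open>Scaling by \<open>u\<close> carries solutions for \<open>t\<close> to solutions for
  \<open>u * t\<close>. A nonresidue \<open>u\<close> exchanges residues and nonresidues, which is
  why \<open>F\<close> then swaps the components.\<close>

lemma rn_count_le:
  assumes "prime p" "2 < p" "u \<in> {0<..<p}"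
  shows "rn_count p t \<le> rn_count p (u * t mod p)"
proof -
  define f where "f = (\<lambda>x. u * x mod p)"
  have cop: "coprime u p" using assms by (intro coprime_less_prime)
  have inj: "inj_on f {0<..<p}" unfolding f_def by (rule inj_on_mult_mod[OF cop]) auto
  define F where "F = (\<lambda>(r, s). if u \<in> Rp p then (f r, f s) else (f s, f r))"
  have fadd: "(f r + f s) mod p = u * ((r + s) mod p) mod p" for r s
    unfolding f_def by (simp add: mod_simps algebra_simps)
  let ?P = "\<lambda>t. {(r, s). r \<in> Rp p \<and> s \<in> Np p \<and> (r + s) mod p = t}"
  have sub: "?P t \<subseteq> {0<..<p} \<times> {0<..<p}" by (auto simp: Rp_def Np_def)
  have fRp: "f x \<in> Rp p \<longleftrightarrow> (u \<in> Rp p \<longleftrightarrow> x \<in> Rp p)"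
    and fNp: "f x \<in> Np p \<longleftrightarrow> (u \<in> Rp p \<longleftrightarrow> x \<in> Np p)" if "x \<in> {0<..<p}" for x
    unfolding f_def using mult_mod_Rp_Np[OF assms that] by blast+
  show ?thesis unfolding rn_count_def
  proof (rule card_inj_on_le)
    have "inj_on F ({0<..<p} \<times> {0<..<p})"
    proof (rule inj_onI, clarify)
      fix x y x' y' assume *: "x \<in> {0<..<p}" "y \<in> {0<..<p}" "x' \<in> {0<..<p}" "y' \<in> {0<..<p}"
        and "F (x, y) = F (x', y')"
      then have "f x = f x'" "f y = f y'" by (simp_all add: F_def split: if_splits)
      then show "x = x' \<and> y = y'" using inj * by (blast dest: inj_onD)
    qed
    then show "inj_on F (?P t)" using sub by (rule inj_on_subset)
    show "F ` ?P t \<subseteq> ?P (u * t mod p)"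
    proof (rule image_subsetI, clarify)
      fix r s r' s' assume rs: "r \<in> Rp p" "s \<in> Np p" and e: "F (r, s) = (r', s')"
      have in': "r \<in> {0<..<p}" "s \<in> {0<..<p}" "r \<notin> Np p" "s \<notin> Rp p" using rs by (auto simp: Rp_def Np_def)
      show "r' \<in> Rp p \<and> s' \<in> Np p \<and> (r' + s') mod p = u * ((r + s) mod p) mod p"
      proof (cases "u \<in> Rp p")
        case True
        then have "r' = f r" "s' = f s" using e by (simp_all add: F_def)
        then show ?thesis using rs True fadd[of r s] fRp[OF in'(1)] fNp[OF in'(2)] by simp
      next
        case False
        then have "r' = f s" "s' = f r" using e by (simp_all add: F_def)
        then show ?thesis using in'(3,4) False fadd[of r s] fRp[OF in'(2)] fNp[OF in'(1)]
          by (simp add: add.commute)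
      qed
    qed
  qed (rule finite_rn)
qed

lemma rn_count_const:
  assumes "prime p" "2 < p" "t \<in> {0<..<p}"
  shows "rn_count p t = rn_count p 1"
proof (rule antisym)
  have "coprime t p" using assms by (intro coprime_less_prime)
  \<comment> \<open>Scaling by \<open>t\<close> and by its inverse \<open>v\<close> gives the two
    inequalities.\<close>
  then obtain v where v: "[t * v = 1] (mod p)" using cong_solve_coprime_nat[of t p] by auto
  then have v1: "(v mod p) * t mod p = 1"
    using assms(2) by (simp add: cong_def mod_mult_left_eq mult.commute[of v])
  then have "v mod p \<noteq> 0" by (intro notI) simp
  then have "v mod p \<in> {0<..<p}" using assms(2) by auto
  from rn_count_le[OF assms(1,2) this, of t] show "rn_count p t \<le> rn_count p 1" using v1 by simp
  show "rn_count p 1 \<le> rn_count p t" using rn_count_le[OF assms, of 1] assms(3) by simp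
qed

text \<open>Since -1 is a residue, no residue and nonresidue sum to 0. Every nonzero element is
  represented equally often, and counting all \<open>2 * N * (2 * N)\<close> pairs over
  \<open>4 * N\<close> elements gives multiplicity \<open>N\<close>.\<close>

lemma gdvd_gen_Rp_mult_gen_Np:
  assumes "prime p" "p = 4 * N + 1" "p - 1 \<in> Rp p"
  shows "gdvd p k (gen (Rp p) * gen (Np p) - smult (int N) (gen {..<p} - 1))"
proof -
  have N: "N > 0" "2 < p" using assms(1,2) not_prime_1 by (cases N; simp)+
  have p0: "p > 0" using N by simp
  let ?S = "Rp p \<times> Np p" and ?f = "\<lambda>(r, s). (r + s) mod p"
  have fib: "{x \<in> ?S. ?f x = t} = {(r, s). r \<in> Rp p \<and> s \<in> Np p \<and> (r + s) mod p = t}" for t by auto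
  \<comment> \<open>Grouping by the value of the sum is needed twice: with \<open>h\<close> constant
    for the count, and with \<open>h\<close> a monomial for the product in the group ring.\<close>
  have grp: "(\<Sum>x\<in>?S. h (?f x)) = (\<Sum>t<p. of_nat (rn_count p t) * h t)" for h :: "nat \<Rightarrow> 'a::comm_ring_1"
  proof -
    have "(\<Sum>x\<in>?S. h (?f x)) = (\<Sum>t<p. \<Sum>x\<in>{x \<in> ?S. ?f x = t}. h (?f x))"
      by (rule sum.group[symmetric]) (use p0 in auto)
    also have "\<dots> = (\<Sum>t<p. \<Sum>x\<in>{x \<in> ?S. ?f x = t}. h t)" by (intro sum.cong) auto
    finally show ?thesis by (simp add: fib rn_count_def)
  qed
  have zero: "rn_count p 0 = 0"
  proof -
    have "False" if rs: "r \<in> Rp p" "s \<in> Np p" "(r + s) mod p = 0" for r s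
    proof -
      have b: "r < p" "0 < r" "s < p" "0 < s" using rs by (auto simp: Rp_def Np_def)
      have "[(p - 1) * r = s] (mod p)"
      proof -
        have "(p - 1) * r + r = p * r" using p0 by (cases p) auto
        then have "[(p - 1) * r + r = s + r] (mod p)" using rs(3) by (simp add: cong_def add.commute)
        then show ?thesis by (simp only: cong_add_rcancel_nat)
      qed
      then have "(p - 1) * r mod p = s" using b by (simp add: cong_def)
      then have "s \<in> Rp p" using mult_mod_Rp_Np(1)[OF assms(1) N(2), of "p - 1" r] assms(3) rs b N by auto
      then show False using rs(2) by (auto simp: Rp_def Np_def)
    qed
    then have "{(r, s). r \<in> Rp p \<and> s \<in> Np p \<and> (r + s) mod p = 0} = {}" by auto
    then show ?thesis unfolding rn_count_def by (simp only: card.empty)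
  qed
  have split: "{..<p} = insert 0 {0<..<p}" using p0 by auto
  have const: "rn_count p t = rn_count p 1" if "t \<in> {0<..<p}" for t
    using rn_count_const[OF assms(1) N(2) that] .
  have sum_split: "(\<Sum>t<p. of_nat (rn_count p t) * h t) = (\<Sum>t\<in>{0<..<p}. of_nat (rn_count p 1) * h t)"
    for h :: "nat \<Rightarrow> 'a::comm_ring_1"
  proof -
    have "(\<Sum>t<p. of_nat (rn_count p t) * h t) = (\<Sum>t\<in>{0<..<p}. of_nat (rn_count p t) * h t)"
      unfolding split by (simp add: zero)
    also have "\<dots> = (\<Sum>t\<in>{0<..<p}. of_nat (rn_count p 1) * h t)"
      by (rule sum.cong[OF refl]) (simp only: const)
    finally show ?thesis .
  qed
  have "int (card ?S) = (\<Sum>t<p. int (rn_count p t))" using grp[of "\<lambda>_. 1::int"] by simp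
  also have "\<dots> = (\<Sum>t\<in>{0<..<p}. int (rn_count p 1))" using sum_split[of "\<lambda>_. 1"] by simp
  also have "\<dots> = int (4 * N * rn_count p 1)" using assms(2) by simp
  finally have "card ?S = 4 * N * rn_count p 1" by (simp only: of_nat_eq_iff)
  moreover have "card ?S = 2 * N * (2 * N)"
    using card_Rp[OF assms(1) N(2)] card_Np[OF assms(1) N(2)] assms(2) by (simp add: card_cartesian_product)
  ultimately have c1: "rn_count p 1 = N" using N by simp
  have "gen (Rp p) * gen (Np p) = (\<Sum>(r, s)\<in>?S. monom 1 (r + s))"
    by (simp add: gen_def sum_product mult_monom sum.cartesian_product)
  moreover have "gdvd p k (\<dots> - (\<Sum>x\<in>?S. monom 1 (?f x)))"
    by (auto intro!: gdvd_sum_cong gdvd_monom_cong simp: cong_def)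
  moreover have "(\<Sum>x\<in>?S. monom 1 (?f x)) = smult (int N) (gen {..<p} - 1)"
  proof -
    have "(\<Sum>x\<in>?S. monom 1 (?f x)) = (\<Sum>t<p. of_nat (rn_count p t) * monom (1::int) t)"
      by (rule grp)
    also have "\<dots> = (\<Sum>t\<in>{0<..<p}. of_nat N * monom (1::int) t)"
      using sum_split[of "monom 1"] by (simp only: c1)
    also have "\<dots> = of_nat N * (gen {..<p} - 1)" unfolding split gen_def
      by (simp add: sum_distrib_left)
    finally show ?thesis by (simp add: of_nat_poly)
  qed
  ultimately show ?thesis by simp
qed

section \<open>Difference sets\<close>

locale residue_difference_set =
  fixes p :: nat and A :: "nat set"
  assumes prime_p: "prime p" and A_sub: "A \<subseteq> Fp p" and diff_rep_A: "diff_rep p A (Rp p)"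
begin

abbreviation "a \<equiv> gen A"
abbreviation "r \<equiv> gen (Rp p)"
abbreviation "nr \<equiv> gen (Np p)"
abbreviation "g \<equiv> gen {..<p}"
abbreviation "n \<equiv> card A"
abbreviation "N \<equiv> (p - 1) div 4"
abbreviation "bar X \<equiv> subst_pow X (p - 1)"

lemma p_gt_1: "p > 1"
  using prime_p prime_gt_1_nat by blast

lemma A_less: "x \<in> A \<Longrightarrow> x < p"
  using A_sub by (auto simp: Fp_def)

lemma A_subset_lessThan: "A \<subseteq> {..<p}"
  using A_less by auto

lemma finite_A: "finite A"
  using A_subset_lessThan finite_subset by blast

lemma diffp_add_cong:
  assumes "y < p"
  shows "[diffp p x y + y = x] (mod p)"
proof -
  have "(diffp p x y + y) mod p = (x + p - y + y) mod p" unfolding diffp_def by (rule mod_add_left_eq)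
  also have "x + p - y + y = x + p" using assms by simp
  finally show ?thesis by (simp add: cong_def)
qed

lemma diffp_cong:
  assumes "y < p"
  shows "[diffp p x y = x + (p - 1) * y] (mod p)"
proof -
  have e: "x + (p - 1) * y + y = x + p * y" using p_gt_1 by (cases p) simp_all
  have "[x = x + (p - 1) * y + y] (mod p)" unfolding e by (simp add: cong_def)
  with diffp_add_cong[OF assms, of x] have "[diffp p x y + y = x + (p - 1) * y + y] (mod p)"
    by (rule cong_trans)
  then show ?thesis by (simp only: cong_add_rcancel_nat)
qed

lemma diffp_self: "diffp p x x = 0"
  by (simp add: diffp_def)

lemma diffp_off: "x \<in> A \<Longrightarrow> y \<in> A \<Longrightarrow> x \<noteq> y \<Longrightarrow> diffp p x y \<in> Rp p"
  using diff_rep_A by (auto simp: diff_rep_def)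

text \<open>In this form the hypothesis on \<open>A\<close> turns sums and counts over off-diagonal
  pairs into sums and counts over the residues.\<close>

lemma bij_betw_differences:
  "bij_betw (\<lambda>(x, y). diffp p x y) {(x, y). x \<in> A \<and> y \<in> A \<and> x \<noteq> y} (Rp p)"
  unfolding bij_betw_def
proof
  have ex1: "\<exists>!(x, y). x \<in> A \<and> y \<in> A \<and> diffp p x y = s" if "s \<in> Rp p" for s
    using diff_rep_A that by (simp add: diff_rep_def)
  show "inj_on (\<lambda>(x, y). diffp p x y) {(x, y). x \<in> A \<and> y \<in> A \<and> x \<noteq> y}"
  proof (rule inj_onI, clarify)
    fix x y x' y' assume *: "x \<in> A" "y \<in> A" "x \<noteq> y" "x' \<in> A" "y' \<in> A" and eq: "diffp p x y = diffp p x' y'"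
    have "\<exists>\<^sub>\<le>\<^sub>1 (v, w). v \<in> A \<and> w \<in> A \<and> diffp p v w = diffp p x y"
      using ex1[OF diffp_off[OF *(1-3)]] unfolding ex1_iff_ex_Uniq by (rule conjunct2)
    from Uniq_D[OF this, of "(x, y)" "(x', y')"] have "(x, y) = (x', y')"
      using * eq by simp
    then show "x = x' \<and> y = y'" by simp
  qed
  show "(\<lambda>(x, y). diffp p x y) ` {(x, y). x \<in> A \<and> y \<in> A \<and> x \<noteq> y} = Rp p"
  proof (intro equalityI subsetI)
    fix s assume s: "s \<in> Rp p"
    then obtain x y where xy: "x \<in> A" "y \<in> A" "diffp p x y = s" using ex1[OF s] by blast
    then have "x \<noteq> y" using s diffp_self by (auto simp: Rp_def)
    then show "s \<in> (\<lambda>(x, y). diffp p x y) ` {(x, y). x \<in> A \<and> y \<in> A \<and> x \<noteq> y}"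
      using xy by force
  qed (auto intro: diffp_off)
qed

section \<open>Arithmetic constraints on \<open>p\<close> and on the size of
  \<open>A\<close>\<close>

lemma one_in_Rp: "1 \<in> Rp p"
  using p_gt_1 unfolding Rp_def QuadRes_def by (auto intro!: exI[of _ 1])

lemma difference_one:
  obtains x y where "x \<in> A" "y \<in> A" "x \<noteq> y" "diffp p x y = 1"
proof -
  have "1 \<in> (\<lambda>(x, y). diffp p x y) ` {(x, y). x \<in> A \<and> y \<in> A \<and> x \<noteq> y}"
    using one_in_Rp bij_betw_differences unfolding bij_betw_def by (simp only:)
  then obtain z where "z \<in> {(x, y). x \<in> A \<and> y \<in> A \<and> x \<noteq> y}" "1 = (\<lambda>(x, y). diffp p x y) z" by (rule imageE)
  then show ?thesis using that[of "fst z" "snd z"] by (auto simp: case_prod_unfold)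
qed

text \<open>The residue 1 is a difference of elements of \<open>A\<close>; reversing it makes -1 a
  difference too, hence a residue.\<close>

lemma minus_one_in_Rp: "p - 1 \<in> Rp p"
proof -
  obtain x y where xy: "x \<in> A" "y \<in> A" "x \<noteq> y" "diffp p x y = 1"
    by (rule difference_one)
  have "[(diffp p x y + y) + (diffp p y x + x) = x + y] (mod p)"
    using xy by (intro cong_add diffp_add_cong A_less)
  then have "[diffp p x y + diffp p y x + (x + y) = 0 + (x + y)] (mod p)" by (simp add: ac_simps)
  then have "[diffp p x y + diffp p y x = 0] (mod p)" by (simp only: cong_add_rcancel_nat)
  then have "p dvd Suc (diffp p y x)" by (simp add: xy(4) cong_0_iff)
  then have "p \<le> Suc (diffp p y x)" by (rule dvd_imp_le) simp
  moreover have "diffp p y x < p" unfolding diffp_def using p_gt_1 by simp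
  ultimately have "diffp p y x = p - 1" by linarith
  then show ?thesis using diffp_off[of y x] xy by simp
qed

text \<open>For \<open>p = 2\<close> a pair and its reversal would both represent 1, against
  uniqueness.\<close>

lemma p_gt_2: "p > 2"
proof (rule ccontr)
  assume "\<not> p > 2"
  then have p: "p = 2" using p_gt_1 by simp
  obtain x y where xy: "x \<in> A" "y \<in> A" "x \<noteq> y" "diffp p x y = 1"
    by (rule difference_one)
  then have "x < 2" "y < 2" using A_less p by auto
  then have "diffp p y x = diffp p x y" using xy(3) p by (auto simp: diffp_def less_2_cases_iff)
  then have "(x, y) = (y, x)"
    by (intro inj_onD[OF bij_betw_imp_inj_on[OF bij_betw_differences]]) (use xy in auto)
  then show False using xy(3) by simp
qed

text \<open>Euler's criterion for the residue -1 forces \<open>(p - 1) div 2\<close> to be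
  even.\<close>

lemma p_eq: "p = 4 * N + 1"
proof -
  have odd: "odd p" using prime_p p_gt_2 prime_odd_nat by blast
  have "Legendre (-1) (int p) = 1"
  proof -
    have "QuadRes (int p) (int (p - 1))" using minus_one_in_Rp by (simp only: Rp_def mem_Collect_eq)
    moreover have "[int (p - 1) = - 1] (mod int p)" using p_gt_1 by (simp add: cong_iff_dvd_diff of_nat_diff)
    ultimately have "QuadRes (int p) (-1)" using QuadRes_cong by blast
    then show ?thesis using p_gt_1 by (auto simp: Legendre_def cong_0_iff)
  qed
  then have c: "[1 = (-1) ^ ((p - 1) div 2)] (mod int p)"
    using euler_criterion[OF prime_p p_gt_2, of "-1"] by simp
  have "even ((p - 1) div 2)"
  proof (rule ccontr)
    assume "odd ((p - 1) div 2)"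
    then have "int p dvd 2" using c by (simp add: cong_iff_dvd_diff)
    then have "int p \<le> 2" by (rule zdvd_imp_le) simp
    then show False using p_gt_2 by simp
  qed
  moreover obtain k where "p = 2 * k + 1" using odd by (rule oddE)
  moreover obtain m where "k = 2 * m" using calculation by auto
  ultimately show ?thesis by simp
qed

lemma N_pos: "N > 0"
  using p_eq p_gt_2 by linarith

lemma N_less: "N < p"
  using p_gt_1 by simp

lemma card_A: "n * n = n + 2 * N"
proof -
  have "A \<times> A = {(x, y). x \<in> A \<and> y \<in> A \<and> x \<noteq> y} \<union> (\<lambda>x. (x, x)) ` A" by auto
  moreover have "finite (A \<times> A)" using finite_A by simp
  ultimately have "card (A \<times> A) = card {(x, y). x \<in> A \<and> y \<in> A \<and> x \<noteq> y} + card ((\<lambda>x. (x, x)) ` A)"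
    by (subst card_Un_disjoint[symmetric]) auto
  moreover have "card ((\<lambda>x. (x, x)) ` A) = n" by (intro card_image inj_onI) simp
  moreover have "card {(x, y). x \<in> A \<and> y \<in> A \<and> x \<noteq> y} = 2 * N"
    using bij_betw_same_card[OF bij_betw_differences] card_Rp[OF prime_p p_gt_2] p_eq by presburger
  ultimately show ?thesis by (simp add: card_cartesian_product)
qed

section \<open>Identities for \<open>A\<close> and the residues in the group ring\<close>

lemma autocorrelation: "gdvd p k (a * bar a - (of_nat n + r))"
proof -
  let ?O = "{(x, y). x \<in> A \<and> y \<in> A \<and> x \<noteq> y}" and ?m = "\<lambda>(x, y). monom (1::int) (diffp p x y)"
  have "a * bar a = (\<Sum>(x, y)\<in>A \<times> A. monom 1 (x + (p - 1) * y))"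
    by (simp add: gen_def pcompose_sum subst_pow_monom sum_product mult_monom sum.cartesian_product)
  moreover have "gdvd p k (\<dots> - sum ?m (A \<times> A))"
    using A_less by (auto intro!: gdvd_sum_cong gdvd_monom_cong cong_sym[OF diffp_cong] simp del: One_nat_def)
  moreover have "sum ?m (A \<times> A) = of_nat n + r"
  proof -
    have "A \<times> A = (\<lambda>x. (x, x)) ` A \<union> ?O" by auto
    moreover have "finite (A \<times> A)" using finite_A by simp
    ultimately have "sum ?m (A \<times> A) = sum ?m ((\<lambda>x. (x, x)) ` A) + sum ?m ?O"
      by (subst sum.union_disjoint[symmetric]) auto
    moreover have "sum ?m ((\<lambda>x. (x, x)) ` A) = of_nat n"
      by (subst sum.reindex) (auto simp: inj_on_def diffp_self)
    moreover have "sum ?m ?O = r"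
      using sum.reindex_bij_betw[OF bij_betw_differences, of "monom (1::int)"]
      by (simp add: gen_def case_prod_unfold)
    ultimately show ?thesis by simp
  qed
  ultimately show ?thesis by simp
qed

lemma r_plus_nr: "r + nr = g - 1"
proof -
  have "r + nr = gen (Rp p \<union> Np p)" unfolding gen_def
    using Rp_Un_Np by (intro sum.union_disjoint[symmetric]) auto
  also have "\<dots> = gen {0<..<p}" by (simp add: Rp_Un_Np)
  also have "{..<p} = insert 0 {0<..<p}" using p_gt_1 by auto
  then have "gen {0<..<p} = g - 1" by (simp add: gen_def)
  finally show ?thesis .
qed

text \<open>Expand and insert \<open>n * n = n + 2 * N\<close>, \<open>r + nr = g - 1\<close> and
  \<open>r * nr = N * (g - 1)\<close>. Thus \<open>of_nat n + nr\<close> inverts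
  \<open>of_nat n + r\<close> up to the factor \<open>N\<close> and a multiple of
  \<open>g\<close>.\<close>

lemma conjugate_product:
  "gdvd p k ((of_nat n + r) * (of_nat n + nr) - (of_nat N + (of_nat n + of_nat N) * g))"
proof -
  have 1: "gdvd p k (r * nr - of_nat N * (g - 1))"
    using gdvd_gen_Rp_mult_gen_Np[OF prime_p p_eq minus_one_in_Rp, of k] by (simp add: of_nat_poly)
  have "(of_nat (n * n) :: int poly) = of_nat (n + 2 * N)" by (simp only: card_A)
  then have c: "of_nat n * of_nat n = of_nat n + 2 * (of_nat N :: int poly)" by simp
  have "(of_nat n + r) * (of_nat n + nr) = of_nat n * of_nat n + of_nat n * (r + nr) + r * nr"
    by (simp add: algebra_simps)
  then have "(of_nat n + r) * (of_nat n + nr) - (of_nat N + (of_nat n + of_nat N) * g)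
      = r * nr - of_nat N * (g - 1)"
    unfolding r_plus_nr c by (simp add: algebra_simps)
  then show ?thesis using 1 by (simp only:)
qed

lemma gdvd_mult_g: "gdvd p k (X * g - of_int (poly X 1) * g)"
  using gdvd_mult_gen_all[of p X] p_gt_1 by (intro gdvd_from_zero[of p _ k]) (simp add: of_int_poly)

lemma subst_pow_r:
  assumes "h \<in> Rp p"
  shows "gdvd p k (subst_pow r h - r)"
proof -
  have h: "h \<in> {0<..<p}" using assms by (auto simp: Rp_def)
  then have cop: "coprime h p" using prime_p by (intro coprime_less_prime)
  have sub: "Rp p \<subseteq> {..<p}" by (auto simp: Rp_def)
  have "(\<lambda>s. h * s mod p) ` Rp p \<subseteq> Rp p"
  proof (rule image_subsetI)
    fix s assume s: "s \<in> Rp p"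
    then have "s \<in> {0<..<p}" by (simp add: Rp_def)
    then show "h * s mod p \<in> Rp p" using mult_mod_Rp_Np(1)[OF prime_p p_gt_2 h] assms s by blast
  qed
  then have "(\<lambda>s. h * s mod p) ` Rp p = Rp p"
    using inj_on_mult_mod[OF cop sub] by (intro endo_inj_surj finite_Rp)
  then show ?thesis using gdvd_subst_pow_gen[OF cop sub, of k] by simp
qed

section \<open>The multiplier criterion\<close>

lemma of_nat_gdvd: "gdvd p (int k) (of_nat k * X)"
  using gdvd_smult_self[of p "int k" X] by (simp add: of_nat_poly)

lemma subst_pow_of_nat: "subst_pow (of_nat k) h = of_nat k"
  by (simp add: of_nat_poly)

lemma multiplier_criterion:
  assumes h: "h \<in> Rp p"
    and pow: "\<And>q. prime q \<Longrightarrow> q dvd N \<Longrightarrow> \<exists>s. [q ^ s = h] (mod p)"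
  shows "h \<in> multipliers p A"
proof -
  have p0: "p > 0" using p_gt_1 by simp
  have hp: "h \<in> {0<..<p}" using h by (auto simp: Rp_def)
  have cop: "coprime h p" using prime_p hp by (intro coprime_less_prime)
  \<comment> \<open>Multiplying the first summand by \<open>a\<close> gives
    \<open>N + (n + N) * g\<close>. Subtracting \<open>g\<close> removes
    \<open>a * g = n * g\<close>, so that what remains is divisible by \<open>N\<close>.\<close>
  define Y where "Y = bar a * (of_nat n + nr) - g"
  define ah where "ah = subst_pow a h"
  have ag: "gdvd p k (a * g - of_nat n * g)" for k using gdvd_mult_g[of k a] by (simp add: poly_gen_1)
  have ahg: "gdvd p k (ah * g - of_nat n * g)" for k using gdvd_mult_g[of k ah]
    by (simp add: poly_gen_1 ah_def poly_subst_pow_1)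
  have aY: "gdvd p k (a * Y - of_nat N * (1 + g))" for k
  proof -
    have "a * Y - of_nat N * (1 + g) =
        (a * bar a - (of_nat n + r)) * (of_nat n + nr)
        + ((of_nat n + r) * (of_nat n + nr) - (of_nat N + (of_nat n + of_nat N) * g))
        - (a * g - of_nat n * g)"
      by (simp add: Y_def algebra_simps)
    then show ?thesis
      using gdvd_diff[OF gdvd_add[OF gdvd_multR[OF autocorrelation] conjugate_product] ag] by simp
  qed
  have NaY: "gdvd p (int N) (a * Y)"
    using gdvd_add[OF aY[of "int N"] of_nat_gdvd[of N "1 + g"]] by simp
  have "gdvd p (int N) (ah * Y)"
  proof (rule gdvd_from_prime_powers[OF N_pos])
    fix q e assume q: "prime q" and e: "q ^ e dvd N"
    show "gdvd p (int q ^ e) (ah * Y)"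
    proof (cases "e = 0")
      case False
      then have "q dvd N" using e dvd_power[of e q] dvd_trans by blast
      then obtain s where s: "[q ^ s = h] (mod p)" using pow q by blast
      have "q < p" using dvd_imp_le[OF \<open>q dvd N\<close> N_pos] N_less by (rule le_less_trans)
      then have "coprime q p" using q prime_p primes_coprime by blast
      moreover have "gdvd p (int q ^ e) (a * Y)"
        by (rule gdvd_dvd[OF NaY]) (use e in \<open>simp flip: of_nat_power\<close>)
      ultimately have "gdvd p (int q ^ e) (subst_pow a (q ^ s) * Y)"
        using gdvd_frobenius_shift_iter[OF p0 q] by blast
      moreover have "gdvd p (int q ^ e) ((subst_pow a (q ^ s) - ah) * Y)"
        unfolding ah_def by (intro gdvd_multR gdvd_subst_pow_cong s)
      ultimately have "gdvd p (int q ^ e) (subst_pow a (q ^ s) * Y - (subst_pow a (q ^ s) - ah) * Y)"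
        by (rule gdvd_diff)
      then show ?thesis by (simp add: algebra_simps)
    qed auto
  qed
  then obtain U W where U: "ah * Y = smult (int N) U + cyc p * W" unfolding gdvd_def by blast
  \<comment> \<open>Computing \<open>ah * Y * a\<close> in two ways, from
    \<open>ah * Y = N * U\<close> and from \<open>a * Y = N * (1 + g)\<close>. The modulus
    \<open>int N * 0\<close> has the shape required for cancelling \<open>N\<close>.\<close>
  have "gdvd p (int N * 0) (smult (int N) (ah * (1 + g) - U * a))"
  proof -
    have "gdvd p 0 (cyc p * (W * a) - ah * (a * Y - of_nat N * (1 + g)))"
      by (rule gdvd_diff[OF _ gdvd_multL[OF aY]]) (simp add: gdvd_zero_iff)
    moreover have "cyc p * (W * a) - ah * (a * Y - of_nat N * (1 + g)) =
       of_nat N * (ah * (1 + g)) - a * (ah * Y - cyc p * W)"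
      by (simp add: algebra_simps)
    moreover have "ah * Y - cyc p * W = of_nat N * U" unfolding U by (simp add: of_nat_poly)
    ultimately have "gdvd p 0 (of_nat N * (ah * (1 + g)) - a * (of_nat N * U))" by simp
    then show ?thesis by (simp add: of_nat_poly smult_diff_right mult.commute)
  qed
  then have Ua: "gdvd p 0 (ah * (1 + g) - U * a)" using gdvd_cancel[OF p0, of "int N" 0] N_pos by simp
  \<comment> \<open>As \<open>ah * g\<close> and \<open>a * g\<close> both equal
    \<open>n * g\<close>, subtracting \<open>g\<close> from \<open>U\<close> turns
    \<open>U * a = ah * (1 + g)\<close> into \<open>V * a = ah\<close>.\<close>
  define V where "V = U - g"
  have Va: "gdvd p 0 (V * a - ah)"
  proof -
    have "V * a - ah = (ah * g - of_nat n * g) - (a * g - of_nat n * g) - (ah * (1 + g) - U * a)"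
      by (simp add: V_def algebra_simps)
    then show ?thesis using gdvd_diff[OF gdvd_diff[OF ahg ag] Ua] by simp
  qed
  have npos: "n > 0" using card_A N_pos by (cases "n = 0") auto
  have V1: "poly V 1 = 1"
    using poly_1_gdvd[OF Va] npos by (simp add: ah_def poly_subst_pow_1 poly_gen_1)
  have "gdvd p 0 (bar (V * a - ah))" by (rule gdvd_subst_pow[OF Va])
  then have Vab: "gdvd p 0 (bar V * bar a - bar ah)" by (simp add: pcompose_diff pcompose_mult)
  \<comment> \<open>A residue \<open>h\<close> permutes the residues, so \<open>ah\<close> has the
    same autocorrelation as \<open>a\<close>.\<close>
  have ahah: "gdvd p 0 (ah * bar ah - (of_nat n + r))"
  proof -
    have "bar ah = subst_pow (bar a) h" by (simp add: ah_def subst_pow_subst_pow mult.commute)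
    then have "ah * bar ah - (of_nat n + subst_pow r h) = subst_pow (a * bar a - (of_nat n + r)) h"
      by (simp add: ah_def pcompose_diff pcompose_mult pcompose_add subst_pow_of_nat)
    then have "gdvd p 0 (ah * bar ah - (of_nat n + subst_pow r h))"
      using gdvd_subst_pow[OF autocorrelation] by simp
    from gdvd_add[OF this subst_pow_r[OF h]] show ?thesis by (simp add: algebra_simps)
  qed
  \<comment> \<open>Comparing autocorrelations shows that \<open>of_nat n + r\<close> annihilates
    \<open>?D\<close>. Multiplying by \<open>of_nat n + nr\<close> leaves \<open>N * ?D\<close>,
    since \<open>?D\<close> has augmentation 0 and is therefore killed by \<open>g\<close>.\<close>
  have "gdvd p (int N * 0) (smult (int N) (V * bar V - 1))"
  proof -
    let ?D = "V * bar V - 1" and ?s = "of_nat n + r" and ?c = "of_nat n + of_nat N :: int poly"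
    have "gdvd p 0 ((V * a) * (bar V * bar a) - ah * bar ah)"
      by (intro gdvd_cong_mult Va Vab)
    then have "gdvd p 0 (((V * a) * (bar V * bar a) - ah * bar ah) + (ah * bar ah - ?s)
        - V * bar V * (a * bar a - ?s))"
      by (rule gdvd_diff[OF gdvd_add[OF _ ahah] gdvd_multL[OF autocorrelation]])
    moreover have "((V * a) * (bar V * bar a) - ah * bar ah) + (ah * bar ah - ?s)
        - V * bar V * (a * bar a - ?s) = ?D * ?s" by (simp add: algebra_simps)
    ultimately have 1: "gdvd p 0 (?D * ?s)" by simp
    have "poly ?D 1 = 0" by (simp add: V1 poly_subst_pow_1)
    then have 2: "gdvd p 0 (?D * g)" using gdvd_mult_g[of 0 ?D] by simp
    have "gdvd p 0 (?D * ?s * (of_nat n + nr) - ?D * (?s * (of_nat n + nr) - (of_nat N + ?c * g)) - ?D * g * ?c)"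
      by (rule gdvd_diff[OF gdvd_diff[OF gdvd_multR[OF 1] gdvd_multL[OF conjugate_product]] gdvd_multR[OF 2]])
    moreover have "?D * ?s * (of_nat n + nr) - ?D * (?s * (of_nat n + nr) - (of_nat N + ?c * g)) - ?D * g * ?c
       = of_nat N * ?D" by (simp add: algebra_simps)
    ultimately show ?thesis by (simp add: of_nat_poly)
  qed
  then have "gdvd p 0 (V * bar V - 1)" using gdvd_cancel[OF p0, of "int N" 0] N_pos by simp
  then obtain j where j: "j < p" "gdvd p 0 (V - monom 1 j)"
    using orthogonal_unit_is_monom[OF p0 _ V1] by blast
  let ?hA = "(\<lambda>x. h * x mod p) ` A" and ?Aj = "(\<lambda>x. (x + j) mod p) ` A"
  have "gdvd p 0 (gen ?hA - gen ?Aj)"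
  proof -
    have "gdvd p 0 (- (subst_pow a h - gen ?hA) + (monom 1 j * a - gen ?Aj) + (V - monom 1 j) * a - (V * a - ah))"
      by (rule gdvd_diff[OF gdvd_add[OF gdvd_add[OF gdvd_uminus[OF gdvd_subst_pow_gen[OF cop A_subset_lessThan]]
            gdvd_monom_mult_gen[OF A_subset_lessThan]] gdvd_multR[OF j(2)]] Va])
    then show ?thesis by (simp add: ah_def algebra_simps)
  qed
  moreover have "degree (gen ?hA) < p" "degree (gen ?Aj) < p"
    by (intro degree_gen; use p0 in auto)+
  ultimately have "gen ?hA = gen ?Aj" by (intro gdvd_zero_eq[OF p0])
  then have "?hA = ?Aj" using finite_A by (simp add: gen_eq_iff)
  then show ?thesis using hp j(1) by (auto simp: multipliers_def Fp_def)
qed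

end

section \<open>Multiplier groups\<close>

text \<open>For a primitive eighth root of unity \<open>z\<close> one has \<open>z ^ 4 = -1\<close>,
  so the square of \<open>z + 1/z\<close> is 2. Here \<open>z ^ 7\<close> serves as the inverse of
  \<open>z\<close>.\<close>

lemma QuadRes_2:
  assumes "prime p" "p = 8 * m + 1"
  shows "QuadRes (int p) 2"
proof -
  have m: "m > 0" using assms not_prime_1 by (cases m) auto
  obtain g where "residue_primroot p g" using prime_primitive_root_exists[OF prime_gt_1_nat] assms(1) by blast
  then have ord: "ord p g = 8 * m" using assms by (simp add: residue_primroot_def totient_prime)
  define z where "z = int g ^ m"
  have "[g ^ (8 * m) = 1] (mod p)" "\<not> [g ^ (4 * m) = 1] (mod p)"
    unfolding ord_divides ord using m by (auto dest: dvd_imp_le)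
  then have "[int (g ^ (8 * m)) = int 1] (mod int p)" "\<not> [int (g ^ (4 * m)) = int 1] (mod int p)"
    unfolding cong_int_iff by auto
  then have z: "int p dvd z ^ 8 - 1" "\<not> int p dvd z ^ 4 - 1"
    by (simp_all add: z_def cong_iff_dvd_diff mult.commute flip: power_mult)
  have "z ^ 8 - 1 = (z ^ 4 - 1) * (z ^ 4 + 1)" by (simp add: algebra_simps flip: power_add)
  then have z4: "int p dvd z ^ 4 + 1" using z assms(1) by (simp add: prime_dvd_mult_iff)
  have "(z + z ^ 7)\<^sup>2 - 2 = z\<^sup>2 * (z ^ 4 + 1) + (2 + z ^ 6) * (z ^ 8 - 1)"
    by (simp add: power2_sum algebra_simps flip: power_add power_mult power_Suc)
  then have "int p dvd (z + z ^ 7)\<^sup>2 - 2" using z(1) z4 by simp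
  then show ?thesis unfolding QuadRes_def cong_iff_dvd_diff by blast
qed

text \<open>For odd \<open>q\<close> the reciprocity sign is +1 because 4 divides
  \<open>p - 1\<close>, and \<open>p\<close> is 1 modulo \<open>q\<close>, hence a square. For
  \<open>q = 2\<close> the number \<open>N\<close> is even, so \<open>p\<close> is 1 modulo
  8.\<close>

lemma QuadRes_of_dvd_quarter:
  assumes "prime p" "p = 4 * N + 1" "prime q" "q dvd N"
  shows "QuadRes (int p) (int q)"
proof (cases "q = 2")
  case True
  then obtain m where "N = 2 * m" using assms(4) by blast
  then show ?thesis using True QuadRes_2[OF assms(1), of m] assms(2) by simp
next
  case False
  then have q: "q > 2" using prime_ge_2_nat[OF assms(3)] by simp
  have N: "N > 0" using assms(1,2) by (intro Nat.gr0I) auto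
  have ne: "p \<noteq> q" "p > 2" using dvd_imp_le[OF assms(4) N] assms(2) N by auto
  have "[int p = 1] (mod int q)" using assms(2,4) by (auto simp: cong_iff_dvd_diff)
  then have p1: "Legendre (int p) (int q) = 1"
  proof -
    have "\<not> [int p = 0] (mod int q)" using primes_dvd_imp_eq[OF assms(3,1)] ne by (auto simp: cong_0_iff)
    moreover have "[1\<^sup>2 = int p] (mod int q)" using \<open>[int p = 1] (mod int q)\<close> by (simp add: cong_sym)
    ultimately show ?thesis unfolding Legendre_def QuadRes_def by (auto intro!: exI[of _ 1])
  qed
  have "(p - 1) div 2 = 2 * N" using assms(2) by simp
  then have "Legendre (int p) (int q) * Legendre (int q) (int p) = 1"
    using Quadratic_Reciprocity[OF assms(1) ne(2) assms(3) q ne(1)] by (simp add: power_mult)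
  then have "Legendre (int q) (int p) = 1" using p1 by simp
  then show ?thesis by (auto simp: Legendre_def split: if_splits)
qed

lemma QuadRes_power: "QuadRes p a \<Longrightarrow> QuadRes p (a ^ k)"
  unfolding QuadRes_def using cong_pow by (metis power_even_eq power_mult mult.commute)

text \<open>The powers of \<open>q\<close> supply \<open>ord p q\<close> distinct roots of
  \<open>x ^ ord p q = 1\<close>, and modulo a prime there can be no more.\<close>

lemma root_of_unity_is_power:
  fixes p q x :: nat
  assumes "prime p" "coprime p q" "[x ^ ord p q = 1] (mod p)"
  shows "\<exists>s. [q ^ s = x] (mod p)"
proof -
  let ?S = "{y \<in> {..<p}. [y ^ ord p q = 1] (mod p)}" and ?T = "(\<lambda>k. q ^ k mod p) ` {..<ord p q}"
  have p: "p > 1" using assms(1) prime_gt_1_nat by blast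
  have "?T \<subseteq> ?S"
  proof (rule image_subsetI)
    fix k
    have "[(q ^ k mod p) ^ ord p q = (q ^ ord p q) ^ k] (mod p)"
      by (simp add: cong_def power_mod mult.commute flip: power_mult)
    also have "[(q ^ ord p q) ^ k = 1 ^ k] (mod p)" by (intro cong_pow ord)
    finally show "q ^ k mod p \<in> ?S" using p by simp
  qed
  moreover have "card ?S \<le> card ?T"
    using roots_mod_prime_bound[OF assms(1), of "ord p q" 1] assms(2)
    by (simp add: card_image[OF inj_power_mod[OF assms(2)]])
  ultimately have "?T = ?S" by (intro card_seteq) auto
  moreover have "x mod p \<in> ?S" using assms(3) p by (simp add: cong_def power_mod)
  ultimately obtain k where "x mod p = q ^ k mod p" by blast
  then show ?thesis by (auto simp: cong_def)
qed

text \<open>Lagrange's theorem: closure already makes \<open>M\<close> a group, since inverses are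
  powers by Euler's theorem.\<close>

lemma ord_dvd_card_mult_closed:
  fixes p z :: nat
  assumes "prime p" "M \<subseteq> {0<..<p}" "1 \<in> M" "\<And>x y. x \<in> M \<Longrightarrow> y \<in> M \<Longrightarrow> x * y mod p \<in> M" "z \<in> M"
  shows "ord p z dvd card M"
proof -
  let ?G = "\<lparr>carrier = M, monoid.mult = (\<lambda>x y. x * y mod p), one = 1\<rparr>"
  have less: "x < p" if "x \<in> M" for x using assms(2) that by auto
  have pow_in: "x ^ k mod p \<in> M" if "x \<in> M" for x k
  proof (induction k)
    case 0
    then show ?case using assms(1,3) prime_gt_1_nat[of p] by simp
  next
    case (Suc k)
    from assms(4)[OF that this] show ?case by (simp add: mod_mult_right_eq)
  qed
  have cop: "coprime x p" if "x \<in> M" for x using coprime_less_prime[OF assms(1)] assms(2) that by blast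
  interpret G: group ?G
  proof (rule groupI, goal_cases)
    case (3 x y w)
    then show ?case by (simp add: mod_mult_left_eq mod_mult_right_eq mult.assoc)
  next
    case (5 x)
    then have x: "x \<in> M" by simp
    have "x ^ (totient p - 1) mod p * x mod p = x ^ totient p mod p"
      using assms(1) prime_gt_1_nat[of p] by (simp add: mod_mult_right_eq power_eq_if[of x "totient p"] mult.commute)
    also have "\<dots> = 1" using euler_theorem[OF cop[OF x]] assms(1) prime_gt_1_nat[of p] by (simp add: cong_def)
    finally show ?case using pow_in[OF x] by auto
  qed (use assms less in \<open>auto simp: mult.commute\<close>)
  have pow: "z [^]\<^bsub>?G\<^esub> k = z ^ k mod p" for k :: nat
    using assms(1) prime_gt_1_nat[of p] by (induction k) (simp_all add: mod_mult_right_eq mult.commute)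
  have "G.ord z = ord p z"
    using assms(1,5) prime_gt_1_nat[of p]
    by (subst G.ord_unique) (simp_all add: pow cong_def del: One_nat_def flip: ord_divides)
  moreover have "G.ord z dvd Coset.order ?G" using assms(5) by (intro G.ord_dvd_group_order) simp
  ultimately show ?thesis by (simp add: Coset.order_def)
qed

section \<open>The group of multipliers\<close>

lemma one_in_multipliers: "p > 1 \<Longrightarrow> 1 \<in> multipliers p A"
  by (auto simp: multipliers_def Fp_def intro!: bexI[of _ 0])

lemma mult_in_multipliers:
  assumes "prime p" and x: "x \<in> multipliers p A" and y: "y \<in> multipliers p A"
  shows "x * y mod p \<in> multipliers p A"
proof -
  obtain s t where xs: "0 < x" "x < p" "(\<lambda>a. (x * a) mod p) ` A = (\<lambda>a. (a + s) mod p) ` A"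
    and yt: "0 < y" "y < p" "(\<lambda>a. (y * a) mod p) ` A = (\<lambda>a. (a + t) mod p) ` A"
    using x y by (auto simp: multipliers_def)
  \<comment> \<open>The combined shift: \<open>x\<close> times \<open>A + t\<close> is
    \<open>x A + x t\<close>, which is \<open>A + s + x t\<close>.\<close>
  let ?u = "(s + x * t) mod p"
  have "\<not> p dvd x * y" using assms(1) xs yt by (auto simp: prime_dvd_mult_iff dest: nat_dvd_not_less)
  then have pos: "0 < x * y mod p" by (simp add: dvd_eq_mod_eq_0)
  have "(\<lambda>a. (x * y mod p) * a mod p) ` A = (\<lambda>b. x * b mod p) ` (\<lambda>a. (y * a) mod p) ` A"
    by (simp add: image_image mod_mult_left_eq mod_mult_right_eq mult.assoc)
  also have "\<dots> = (\<lambda>c. (c + x * t) mod p) ` (\<lambda>a. (x * a) mod p) ` A"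
    unfolding yt(3) by (simp add: image_image mod_mult_right_eq mod_add_left_eq distrib_left)
  also have "\<dots> = (\<lambda>a. (a + ?u) mod p) ` A"
    unfolding xs(3) by (simp add: image_image mod_add_left_eq mod_add_right_eq add.assoc)
  finally show ?thesis using pos xs(2) by (auto simp: multipliers_def Fp_def intro!: bexI[of _ ?u])
qed

lemma multipliers_subset: "multipliers p A \<subseteq> {0<..<p}"
  by (auto simp: multipliers_def)

theorem theorem3:
  fixes p :: nat and A :: "nat set"
  assumes "prime p"
    and "A \<subseteq> Fp p"
    and "diff_rep p A (Rp p)"
  shows "{x \<in> Fp p. 0 < x \<and> [x ^ Gp p = 1] (mod p)} \<subseteq> multipliers p A
         \<and> Gp p dvd card (multipliers p A)"
proof -
  interpret residue_difference_set p A by unfold_locales (fact assms)+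
  let ?Q = "{q. prime q \<and> q dvd N}"
  have Gp_dvd: "Gp p dvd ord p q" if "q \<in> ?Q" for q
    using that by (auto simp: Gp_def intro!: Gcd_dvd)
  have cop: "coprime p q" if "q \<in> ?Q" for q
  proof -
    have "q < p" using that dvd_imp_le[of q N] N_pos N_less by auto
    then show ?thesis using that assms(1) primes_coprime by blast
  qed
  have roots: "x \<in> multipliers p A" if x: "x \<in> {0<..<p}" "[x ^ Gp p = 1] (mod p)" for x
  proof (cases "?Q = {}")
    \<comment> \<open>No prime divides \<open>N\<close>, so \<open>N = 1\<close> and
      \<open>p = 5\<close>; the convention \<open>Gp p = 1\<close> leaves only the root 1.\<close>
    case True
    then have "[x = 1] (mod p)" using x(2) by (simp add: Gp_def)
    then have "x = 1" using x(1) p_gt_1 by (simp add: cong_def)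
    then show ?thesis using one_in_multipliers p_gt_1 by simp
  next
    case False
    have pow: "\<exists>s. [q ^ s = x] (mod p)" if "q \<in> ?Q" for q
    proof (rule root_of_unity_is_power[OF assms(1) cop[OF that]])
      obtain k where "ord p q = Gp p * k" using Gp_dvd[OF \<open>q \<in> ?Q\<close>] by blast
      then show "[x ^ ord p q = 1] (mod p)" using cong_pow[OF x(2), of k] by (simp add: power_mult)
    qed
    \<comment> \<open>Any single prime of \<open>?Q\<close> suffices here: it is a residue, hence so
      is its power \<open>x\<close>.\<close>
    obtain q s where q: "q \<in> ?Q" "[q ^ s = x] (mod p)" using False pow by blast
    have "QuadRes (int p) (int q ^ s)"
      using q(1) by (intro QuadRes_power QuadRes_of_dvd_quarter[OF assms(1) p_eq]) auto
    moreover have "[int q ^ s = int x] (mod int p)" using q(2) by (metis cong_int_iff of_nat_power)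
    ultimately have "QuadRes (int p) (int x)" using QuadRes_cong by blast
    then have "x \<in> Rp p" using x(1) by (simp add: Rp_def)
    then show ?thesis using pow by (intro multiplier_criterion) auto
  qed
  have "Gp p dvd p - 1"
  proof (cases "?Q = {}")
    case False
    then obtain q where q: "q \<in> ?Q" by blast
    have "ord p q dvd p - 1" using order_divides_totient[of p q] cop[OF q] assms(1)
      by (simp add: totient_prime)
    then show ?thesis using Gp_dvd[OF q] dvd_trans by blast
  qed (simp add: Gp_def)
  \<comment> \<open>An element \<open>z\<close> of exact order \<open>Gp p\<close> exists because
    \<open>Gp p\<close> divides \<open>p - 1\<close>. It is a multiplier, so its order divides the
    number of multipliers.\<close>
  then have "card {x \<in> totatives p. ord p x = Gp p} = totient (Gp p)"
    using prime_card_elements_with_ord_eq_totient[OF p_gt_1 assms(1), of "Gp p"] by simp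
  moreover have "Gp p > 0" using \<open>Gp p dvd p - 1\<close> p_gt_1 by (auto intro!: Nat.gr0I)
  ultimately have "card {x \<in> totatives p. ord p x = Gp p} > 0" by simp
  then obtain z where z: "z \<in> totatives p" "ord p z = Gp p" by (auto simp: card_gt_0_iff)
  have "z \<in> {0<..<p}" using z(1) totatives_less[OF z(1) p_gt_1] by (simp add: in_totatives_iff)
  then have "z \<in> multipliers p A" using roots[of z] z(2) ord[of z p] by simp
  then have "ord p z dvd card (multipliers p A)"
    using one_in_multipliers[OF p_gt_1] mult_in_multipliers[OF assms(1)] multipliers_subset
    by (intro ord_dvd_card_mult_closed assms(1)) auto
  then show ?thesis using roots z(2) by (auto simp: Fp_def)
qed

end
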